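(* Let $n\ge 2$ be an integer. Let $\mathcal{U}$ be a von Neumann algebra with unit element $I$ and center $\mathrm{Z}(\mathcal{U})$, and let $E_1+E_2=I$, where $E_1$ and $E_2$ are two orthogonal central projections such that $\mathcal{U}E_1$ is of type $I_1$ and $\mathcal{U}E_2$ is a von Neumann algebra with no central summands of type $I_1$. Suppose that $P\in\mathcal{U}E_2$ is a core-free projection with central carrier $E_2$. Let $\phi:\mathcal{U}\to\mathcal{U}$ be an additive map. Then $\phi$ satisfies $$\phi(p_n(A_1,A_2,\ldots,A_n))=p_n(\phi(A_1),A_2,A_3,\ldots,A_n)=p_n(A_1,\phi(A_2),A_3,\ldots,A_n)$$ for all $A_1,A_2,\ldots,A_n\in\mathcal{U}$ with $A_1A_2=P$ if and only if there exist an element $W\in\mathrm{Z}(\mathcal{U})$ and an additive map $\xi:\mathcal{U}\to\mathrm{Z}(\mathcal{U})$ such that $\phi(A)=WA+\xi(A)$ for all $A\in\mathcal{U}$ and $\xi(p_n(A_1,A_2,\ldots,A_n))=0$ for all $A_1,A_2,\ldots,A_n\in\mathcal{U}$ with $A_1A_2=P$.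
   Context: A von Neumann algebra is a weakly closed, self-adjoint algebra of bounded operators on a complex Hilbert space $\mathcal{H}$ containing the identity operator $I$. A projection is a self-adjoint idempotent. $[A,B]=AB-BA$; $p_1(A_1)=A_1$ and $p_n(A_1,\ldots,A_n)=[p_{n-1}(A_1,\ldots,A_{n-1}),A_n]$ for $n\ge 2$. The central carrier of $T\in\mathcal{U}$, denoted $\overline{T}$, is the smallest central projection $Q$ with $QT=T$. The core of a self-adjoint $S\in\mathcal{U}$ is $\underline{S}=\sup\{W\in\mathrm{Z}(\mathcal{U}):W=W^*,\ W\le S\}$. A projection $P$ is core-free if $\underline{P}=0$. A von Neumann algebra of type $I_1$ is an abelian one. *)

theory Defs
  imports "HOL-Analysis.Analysis"
begin

text \<open>
  Complex Hilbert spaces. The inner product is linear in the first argument. The real structure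
  of the type (\<open>scaleR\<close>, \<open>inner\<close>, \<open>norm\<close>) is forced to be the one induced by the complex
  structure, so positive definiteness and completeness are inherited from \<open>real_inner\<close> and
  \<open>complete_space\<close>.
\<close>

class complex_hilbert = real_inner + complete_space +
  fixes scaleC :: "complex \<Rightarrow> 'a \<Rightarrow> 'a" (infixr "*\<^sub>C" 75)
    and cinner :: "'a \<Rightarrow> 'a \<Rightarrow> complex"
  assumes scaleC_add_right: "a *\<^sub>C (x + y) = a *\<^sub>C x + a *\<^sub>C y"
    and scaleC_add_left: "(a + b) *\<^sub>C x = a *\<^sub>C x + b *\<^sub>C x"
    and scaleC_scaleC: "a *\<^sub>C (b *\<^sub>C x) = (a * b) *\<^sub>C x"
    and scaleC_of_real: "of_real r *\<^sub>C x = r *\<^sub>R x"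
    and cinner_commute: "cinner x y = cnj (cinner y x)"
    and cinner_add_left: "cinner (x + y) z = cinner x z + cinner y z"
    and cinner_scaleC_left: "cinner (a *\<^sub>C x) y = a * cinner x y"
    and inner_eq_Re_cinner: "inner x y = Re (cinner x y)"
begin

subclass banach ..

end

instantiation complex :: complex_hilbert
begin

definition scaleC_complex :: "complex \<Rightarrow> complex \<Rightarrow> complex"
  where "scaleC_complex a x = a * x"

definition cinner_complex :: "complex \<Rightarrow> complex \<Rightarrow> complex"
  where "cinner_complex x y = x * cnj y"

instance
  by standard
    (simp_all add: scaleC_complex_def cinner_complex_def inner_complex_def algebra_simps
      scaleR_conv_of_real)

end

lemma cinner_self: "cinner x x = of_real ((norm x)\<^sup>2)"
proof -
  have "Im (cinner x x) = 0"
    using cinner_commute[of x x] by (metis complex_cnj_cancel_iff cnj.simps(2) neg_equal_zero)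
  moreover have "Re (cinner x x) = (norm x)\<^sup>2"
    by (simp add: inner_eq_Re_cinner[symmetric] power2_norm_eq_inner)
  ultimately show ?thesis
    by (simp add: complex_eq_iff)
qed

lemma norm_scaleC: "norm (a *\<^sub>C x) = cmod a * norm x"
proof -
  have "cinner (a *\<^sub>C x) (a *\<^sub>C x) = a * cnj a * cinner x x"
    by (metis cinner_commute cinner_scaleC_left complex_cnj_mult mult.assoc)
  then have "complex_of_real ((norm (a *\<^sub>C x))\<^sup>2) = of_real ((cmod a * norm x)\<^sup>2)"
    by (simp add: cinner_self complex_norm_square[symmetric] power_mult_distrib)
  then have "(norm (a *\<^sub>C x))\<^sup>2 = (cmod a * norm x)\<^sup>2"
    by (simp only: of_real_eq_iff)
  then show ?thesis
    by (simp add: power2_eq_iff_nonneg)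
qed

lemma bounded_linear_scaleC: "bounded_linear (\<lambda>x. a *\<^sub>C x)"
proof (rule bounded_linear_intro[where K = "cmod a"])
  show "a *\<^sub>C (r *\<^sub>R x) = r *\<^sub>R (a *\<^sub>C x)" for r x
    by (metis mult.commute scaleC_of_real scaleC_scaleC)
qed (simp_all add: scaleC_add_right norm_scaleC)

text \<open>
  Bounded operators on \<open>\<H>\<close> are the elements of \<open>'h \<Rightarrow>\<^sub>L 'h\<close> (bounded real-linear maps) that
  are moreover complex-linear.
\<close>

type_synonym 'h operator = "'h \<Rightarrow>\<^sub>L 'h"

definition complex_linear_op :: "'h::complex_hilbert operator \<Rightarrow> bool"
  where "complex_linear_op A \<longleftrightarrow> (\<forall>c x. A (c *\<^sub>C x) = c *\<^sub>C A x)"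

lift_definition scaleC_op :: "complex \<Rightarrow> 'h::complex_hilbert operator \<Rightarrow> 'h operator"
  is "\<lambda>c A x. c *\<^sub>C A x"
  using bounded_linear_compose[OF bounded_linear_scaleC] by blast

definition is_adjoint :: "'h::complex_hilbert operator \<Rightarrow> 'h operator \<Rightarrow> bool"
  where "is_adjoint A B \<longleftrightarrow> (\<forall>x y. cinner (A x) y = cinner x (B y))"

definition selfadjoint_op :: "'h::complex_hilbert operator \<Rightarrow> bool"
  where "selfadjoint_op A \<longleftrightarrow> is_adjoint A A"

definition projection_op :: "'h::complex_hilbert operator \<Rightarrow> bool"
  where "projection_op A \<longleftrightarrow> selfadjoint_op A \<and> A o\<^sub>L A = A"

text \<open>
  The usual order of self-adjoint operators, \<open>T - S \<ge> 0\<close>; it is only used for self-adjoint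
  \<open>S\<close> and \<open>T\<close>, for which both inner products are real.
\<close>

definition op_le :: "'h::complex_hilbert operator \<Rightarrow> 'h operator \<Rightarrow> bool"
  where "op_le S T \<longleftrightarrow> (\<forall>x. Re (cinner (S x) x) \<le> Re (cinner (T x) x))"

text \<open>
  The weak operator topology, in the style of \<^const>\<open>strong_operator_topology\<close>. The
  complex-linear operators are closed in it, so it does not matter for \<open>von_neumann_algebra\<close>
  below that the topology also lives on operators that are only real-linear.
\<close>

definition weak_operator_topology :: "'h::complex_hilbert operator topology"
  where "weak_operator_topology =
    pullback_topology UNIV (\<lambda>A (x, y). cinner (blinfun_apply A x) y) euclidean"

definition von_neumann_algebra :: "'h::complex_hilbert operator set \<Rightarrow> bool"
  where "von_neumann_algebra U \<longleftrightarrow>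
    (\<forall>A\<in>U. complex_linear_op A) \<and>
    id_blinfun \<in> U \<and>
    (\<forall>A\<in>U. \<forall>B\<in>U. A + B \<in> U) \<and>
    (\<forall>c. \<forall>A\<in>U. scaleC_op c A \<in> U) \<and>
    (\<forall>A\<in>U. \<forall>B\<in>U. A o\<^sub>L B \<in> U) \<and>
    (\<forall>A\<in>U. \<exists>B\<in>U. is_adjoint A B) \<and>
    closedin weak_operator_topology U"

definition center :: "'h::complex_hilbert operator set \<Rightarrow> 'h operator set"
  where "center U = {Z \<in> U. \<forall>A\<in>U. Z o\<^sub>L A = A o\<^sub>L Z}"

definition central_projection :: "'h::complex_hilbert operator set \<Rightarrow> 'h operator \<Rightarrow> bool"
  where "central_projection U Q \<longleftrightarrow> Q \<in> center U \<and> projection_op Q"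

text \<open>
  The algebra \<open>\<U>E\<close>, for a central projection \<open>E\<close>, is kept as a set of operators on the whole
  space; its unit is \<open>E\<close>.
\<close>

definition summand :: "'h::complex_hilbert operator set \<Rightarrow> 'h operator \<Rightarrow> 'h operator set"
  where "summand U E = (\<lambda>A. A o\<^sub>L E) ` U"

definition type_I1 :: "'h::complex_hilbert operator set \<Rightarrow> bool"
  where "type_I1 M \<longleftrightarrow> (\<forall>A\<in>M. \<forall>B\<in>M. A o\<^sub>L B = B o\<^sub>L A)"

definition no_type_I1_central_summand :: "'h::complex_hilbert operator set \<Rightarrow> bool"
  where "no_type_I1_central_summand M \<longleftrightarrow>
    (\<forall>Q. central_projection M Q \<and> Q \<noteq> 0 \<longrightarrow> \<not> type_I1 (summand M Q))"

text \<open>\<open>Q\<close> is the central carrier of \<open>T\<close>: the smallest central projection with \<open>QT = T\<close>.\<close>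

definition is_central_carrier ::
    "'h::complex_hilbert operator set \<Rightarrow> 'h operator \<Rightarrow> 'h operator \<Rightarrow> bool"
  where "is_central_carrier U T Q \<longleftrightarrow>
    central_projection U Q \<and> Q o\<^sub>L T = T \<and>
    (\<forall>R. central_projection U R \<and> R o\<^sub>L T = T \<longrightarrow> op_le Q R)"

definition central_minorants ::
    "'h::complex_hilbert operator set \<Rightarrow> 'h operator \<Rightarrow> 'h operator set"
  where "central_minorants U S = {W \<in> center U. selfadjoint_op W \<and> op_le W S}"

text \<open>
  \<open>C\<close> is the core of \<open>S\<close>: the supremum of the central minorants of \<open>S\<close>, taken in the
  ordered space of self-adjoint central elements.
\<close>

definition is_core ::
    "'h::complex_hilbert operator set \<Rightarrow> 'h operator \<Rightarrow> 'h operator \<Rightarrow> bool"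
  where "is_core U S C \<longleftrightarrow>
    C \<in> center U \<and> selfadjoint_op C \<and>
    (\<forall>W\<in>central_minorants U S. op_le W C) \<and>
    (\<forall>D\<in>center U. selfadjoint_op D \<and> (\<forall>W\<in>central_minorants U S. op_le W D) \<longrightarrow> op_le C D)"

definition core_free :: "'h::complex_hilbert operator set \<Rightarrow> 'h operator \<Rightarrow> bool"
  where "core_free U P \<longleftrightarrow> is_core U P 0"

definition commutator :: "'h::complex_hilbert operator \<Rightarrow> 'h operator \<Rightarrow> 'h operator"
  where "commutator A B = (A o\<^sub>L B) - (B o\<^sub>L A)"

text \<open>
  \<open>pn n A\<close> is \<open>p\<^sub>n(A\<^sub>1, \<dots>, A\<^sub>n)\<close>, the arguments being \<open>A 1, \<dots>, A n\<close>; the value at \<open>n = 0\<close>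
  is a dummy.
\<close>

fun pn :: "nat \<Rightarrow> (nat \<Rightarrow> 'h::complex_hilbert operator) \<Rightarrow> 'h operator" where
  "pn 0 A = 0"
| "pn (Suc 0) A = A 1"
| "pn (Suc (Suc n)) A = commutator (pn (Suc n) A) (A (Suc (Suc n)))"

definition additive_on :: "'a::ab_group_add set \<Rightarrow> ('a \<Rightarrow> 'b::ab_group_add) \<Rightarrow> bool"
  where "additive_on U f \<longleftrightarrow> (\<forall>A\<in>U. \<forall>B\<in>U. f (A + B) = f A + f B)"

end

theory Submission
  imports Defs
begin

text \<open>
  Put \<open>Q = I - P\<close>. Substituting \<open>A\<^sub>3 = \<dots> = A\<^sub>n = P\<close>, only the off-diagonal Peirce corners \<open>P U Q\<close> and \<open>Q U P\<close> of
  \<open>[A\<^sub>1, A\<^sub>2]\<close> survive, up to signs. Testing pairs such as \<open>(P + b, P)\<close>, \<open>(P + b, P - b d + d)\<close> and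
  \<open>(c\<^sup>-\<^sup>1 + b, c)\<close>, with \<open>b \<in> P U Q\<close>, \<open>d \<in> Q U Q\<close> and \<open>c\<close> invertible in \<open>P U P\<close>, shows that \<open>\<phi> P\<close> commutes with \<open>P\<close>,
  that its corners \<open>P \<phi>(P) P\<close> and \<open>Q \<phi>(P) Q\<close> are central in \<open>P U P\<close> and \<open>Q U Q\<close>, and that
  \<open>\<phi> b = \<phi>(P) b - b \<phi>(P)\<close>. Extending the two corners to elements \<open>Y\<close>, \<open>Z\<close> of the center of \<open>U\<close> gives \<open>W = Y - Z\<close>.
  The map \<open>A \<mapsto> \<phi> A - W A\<close> satisfies the same identities and vanishes on \<open>P U Q\<close> and \<open>Q U P\<close>, and the same
  test pairs then show that it takes central values.

  Two facts about von Neumann algebras enter, both obtained from the decreasing net \<open>(1 + S)\<^sup>-\<^sup>1\<close> indexed by the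
  positive elements \<open>S\<close> of the ideal generated by a projection \<open>e\<close>: the annihilator of the ideal is generated by a
  central projection, and every central element of \<open>e U e\<close> has the form \<open>\<zeta> e\<close> with \<open>\<zeta>\<close> in the center of \<open>U\<close>.
\<close>

section \<open>Operators and strong limits\<close>

notation blinfun_compose (infixl "\<cdot>" 70)

lemma compose_assoc: "A \<cdot> B \<cdot> C = A \<cdot> (B \<cdot> C)"
  by (rule blinfun_eqI) simp

lemmas compose_bilinear =
  bounded_bilinear.add_left[OF bounded_bilinear_blinfun_compose]
  bounded_bilinear.add_right[OF bounded_bilinear_blinfun_compose]
  bounded_bilinear.diff_left[OF bounded_bilinear_blinfun_compose]
  bounded_bilinear.diff_right[OF bounded_bilinear_blinfun_compose]
  bounded_bilinear.minus_left[OF bounded_bilinear_blinfun_compose]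
  bounded_bilinear.minus_right[OF bounded_bilinear_blinfun_compose]

lemma compose_id [simp]: "id_blinfun \<cdot> A = A" "A \<cdot> id_blinfun = A"
  by (auto intro: blinfun_eqI)

text \<open>The imaginary part of a complex number is the real part of its product with
  \<open>- \<i>\<close>. Limits and symmetry can thus be checked with the real inner product
  alone.\<close>

lemma cinner_eq_inner: "cinner x y = Complex (inner x y) (inner ((- \<i>) *\<^sub>C x) y)"
  by (simp add: inner_eq_Re_cinner cinner_scaleC_left complex_eq_iff)

lemma tendsto_cinner_left:
  assumes "(f \<longlongrightarrow> l) F"
  shows "((\<lambda>i. cinner (f i) y) \<longlongrightarrow> cinner l y) F"
proof -
  have "((\<lambda>i. (- \<i>) *\<^sub>C f i) \<longlongrightarrow> (- \<i>) *\<^sub>C l) F"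
    using bounded_linear.tendsto[OF bounded_linear_scaleC assms] .
  then show ?thesis
    unfolding cinner_eq_inner
    by (intro tendsto_Complex tendsto_inner assms tendsto_const)
qed

lemma is_adjoint_inner: "is_adjoint A B \<Longrightarrow> inner (A x) y = inner x (B y)"
  by (simp add: is_adjoint_def inner_eq_Re_cinner)

lemma is_adjoint_sym: "is_adjoint A B \<Longrightarrow> is_adjoint B A"
  unfolding is_adjoint_def by (metis cinner_commute)

text \<open>Applying the real identity to \<open>(- \<i>) *\<^sub>C x\<close> recovers the imaginary
  part, because \<open>A\<close> is complex-linear.\<close>

lemma is_adjoint_if_inner:
  assumes "complex_linear_op A"
    and "\<And>x y. inner (blinfun_apply A x) y = inner x (blinfun_apply B y)"
  shows "is_adjoint A B"
  unfolding is_adjoint_def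
proof (intro allI)
  fix x y
  have "inner ((- \<i>) *\<^sub>C A x) y = inner ((- \<i>) *\<^sub>C x) (B y)"
    using assms(2)[of "(- \<i>) *\<^sub>C x" y] assms(1) by (simp add: complex_linear_op_def)
  then show "cinner (A x) y = cinner x (B y)"
    by (simp add: cinner_eq_inner assms(2))
qed

text \<open>The Cauchy criterion along an arbitrary filter: centres \<open>y n\<close> for the radii
  \<open>1 / (n + 1)\<close> form a Cauchy sequence because two eventual properties hold at a common
  index, and the limit of this sequence attracts \<open>h\<close>.\<close>

lemma convergent_if_eventually_close:
  fixes h :: "'i \<Rightarrow> 'a::complete_space"
  assumes "F \<noteq> bot" and close: "\<And>e. e > 0 \<Longrightarrow> \<exists>y. \<forall>\<^sub>F i in F. dist (h i) y < e"
  shows "\<exists>l. (h \<longlongrightarrow> l) F"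
proof -
  have "\<forall>n. \<exists>y. \<forall>\<^sub>F i in F. dist (h i) y < inverse (real (Suc n))"
    using close by simp
  then obtain y where y: "\<And>n. \<forall>\<^sub>F i in F. dist (h i) (y n) < inverse (real (Suc n))"
    by metis
  have yy: "dist (y n) (y m) < inverse (real (Suc n)) + inverse (real (Suc m))" for n m
  proof -
    obtain i where "dist (h i) (y n) < inverse (real (Suc n))" "dist (h i) (y m) < inverse (real (Suc m))"
      using eventually_happens'[OF assms(1) eventually_conj[OF y[of n] y[of m]]] by blast
    then show ?thesis
      using dist_triangle3[of "y n" "y m" "h i"] by linarith
  qed
  have "Cauchy y"
  proof (rule metric_CauchyI)
    fix e :: real assume "e > 0"
    then obtain M where M: "inverse (real (Suc M)) < e / 2"
      using reals_Archimedean[of "e / 2"] by auto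
    have "dist (y m) (y n) < e" if "m \<ge> M" "n \<ge> M" for m n
    proof -
      have "inverse (real (Suc m)) \<le> inverse (real (Suc M))" "inverse (real (Suc n)) \<le> inverse (real (Suc M))"
        using that by (simp_all add: le_imp_inverse_le)
      then show ?thesis using yy[of m n] M by linarith
    qed
    then show "\<exists>M. \<forall>m\<ge>M. \<forall>n\<ge>M. dist (y m) (y n) < e" by blast
  qed
  then obtain l where l: "y \<longlonglongrightarrow> l"
    using Cauchy_convergent convergent_def by blast
  have "(h \<longlongrightarrow> l) F"
  proof (rule tendstoI)
    fix e :: real assume "e > 0"
    have "\<forall>\<^sub>F n in sequentially. inverse (real (Suc n)) < e / 2 \<and> dist (y n) l < e / 2"
      using order_tendstoD(2)[OF LIMSEQ_inverse_real_of_nat, of "e/2"] tendstoD[OF l, of "e/2"] \<open>e > 0\<close>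
      by (auto intro: eventually_conj)
    then obtain n where n: "inverse (real (Suc n)) < e / 2" "dist (y n) l < e / 2"
      using eventually_happens'[OF sequentially_bot] by blast
    show "\<forall>\<^sub>F i in F. dist (h i) l < e"
      using y[of n]
    proof eventually_elim
      case (elim i)
      then show ?case using dist_triangle[of "h i" l "y n"] n by linarith
    qed
  qed
  then show ?thesis by blast
qed

lemma strong_limit_exists:
  fixes f :: "'i \<Rightarrow> 'a::real_normed_vector \<Rightarrow>\<^sub>L 'b::banach"
  assumes F: "F \<noteq> bot" and bound: "\<forall>\<^sub>F i in F. norm (f i) \<le> C"
    and conv: "\<And>x. \<exists>l. ((\<lambda>i. f i x) \<longlongrightarrow> l) F"
  shows "\<exists>R :: 'a \<Rightarrow>\<^sub>L 'b. \<forall>x. ((\<lambda>i. f i x) \<longlongrightarrow> R x) F"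
proof -
  obtain r where r: "\<And>x. ((\<lambda>i. f i x) \<longlongrightarrow> r x) F"
    using conv by metis
  have "bounded_linear r"
  proof (rule bounded_linear_intro[where K = C])
    show "r (x + y) = r x + r y" for x y
      using tendsto_unique[OF F r[of "x + y"]] tendsto_add[OF r[of x] r[of y]]
      by (simp add: blinfun.add_right)
    show "r (c *\<^sub>R x) = c *\<^sub>R r x" for c x
      using tendsto_unique[OF F r[of "c *\<^sub>R x"]] tendsto_scaleR[OF tendsto_const r[of x], of c]
      by (simp add: blinfun.scaleR_right)
    show "norm (r x) \<le> norm x * C" for x
    proof (rule tendsto_upperbound[OF tendsto_norm[OF r[of x]] _ F])
      show "\<forall>\<^sub>F i in F. norm (f i x) \<le> norm x * C"
        using bound
      proof eventually_elim
        case (elim i)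
        have "norm (f i x) \<le> norm (f i) * norm x" by (rule norm_blinfun)
        also have "\<dots> \<le> C * norm x" using elim by (simp add: mult_right_mono)
        finally show ?case by (simp add: mult.commute)
      qed
    qed
  qed
  then show ?thesis
    using r by (intro exI[of _ "Blinfun r"]) (simp add: bounded_linear_Blinfun_apply)
qed

section \<open>Closure of a von Neumann algebra under strong limits and Neumann series\<close>

locale von_neumann =
  fixes U :: "'h::complex_hilbert operator set"
  assumes vn: "von_neumann_algebra U"
begin

lemma complex_linear: "A \<in> U \<Longrightarrow> complex_linear_op A"
  using vn by (simp add: von_neumann_algebra_def)

lemma id_in [simp, intro]: "id_blinfun \<in> U"
  using vn by (simp add: von_neumann_algebra_def)

lemma add_in [simp, intro]: "A \<in> U \<Longrightarrow> B \<in> U \<Longrightarrow> A + B \<in> U"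
  using vn by (simp add: von_neumann_algebra_def)

lemma compose_in [simp, intro]: "A \<in> U \<Longrightarrow> B \<in> U \<Longrightarrow> A \<cdot> B \<in> U"
  using vn by (simp add: von_neumann_algebra_def)

lemma scaleR_in [simp, intro]: assumes "A \<in> U" shows "c *\<^sub>R A \<in> U"
proof -
  have "scaleC_op (of_real c) A \<in> U"
    using vn assms by (simp add: von_neumann_algebra_def)
  also have "scaleC_op (of_real c) A = c *\<^sub>R A"
    by (rule blinfun_eqI) (simp add: scaleC_op.rep_eq scaleC_of_real blinfun.scaleR_left)
  finally show ?thesis .
qed

lemma uminus_in [simp, intro]: "A \<in> U \<Longrightarrow> - A \<in> U"
  using scaleR_in[of A "-1"] by simp

lemma diff_in [simp, intro]: "A \<in> U \<Longrightarrow> B \<in> U \<Longrightarrow> A - B \<in> U"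
  using add_in[of A "- B"] by simp

lemma zero_in [simp, intro]: "0 \<in> U"
  using diff_in[OF id_in id_in] by simp

lemma adjoint_in: "A \<in> U \<Longrightarrow> \<exists>B\<in>U. is_adjoint A B"
  using vn by (simp add: von_neumann_algebra_def)

text \<open>Strong convergence gives convergence of every coefficient
  \<open>cinner (f i x) y\<close>, hence convergence in the topology in which \<open>U\<close> is
  closed.\<close>

lemma strong_limit_in:
  assumes F: "F \<noteq> bot" and f: "\<forall>\<^sub>F i in F. f i \<in> U"
    and lim: "\<And>x. ((\<lambda>i. blinfun_apply (f i) x) \<longlongrightarrow> blinfun_apply R x) F"
  shows "R \<in> U"
proof (rule ccontr)
  assume "R \<notin> U"
  define g :: "'h operator \<Rightarrow> 'h \<times> 'h \<Rightarrow> complex" where "g A = (\<lambda>(x, y). cinner (A x) y)" for A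
  have "closedin (pullback_topology UNIV g euclidean) U"
    using vn by (simp add: von_neumann_algebra_def weak_operator_topology_def g_def[abs_def])
  then have "openin (pullback_topology UNIV g euclidean) (UNIV - U)"
    by (simp add: closedin_def topspace_pullback_topology)
  then obtain V where V: "open V" "UNIV - U = g -` V"
    by (auto simp: openin_pullback_topology)
  have "limitin (product_topology (\<lambda>_. euclidean) UNIV) (\<lambda>i. g (f i)) (g R) F"
    unfolding limitin_componentwise
    by (auto simp: g_def intro!: tendsto_cinner_left lim)
  then have "((\<lambda>i. g (f i)) \<longlongrightarrow> g R) F"
    by (simp only: euclidean_product_topology limitin_canonical_iff)
  moreover have "g R \<in> V" using V \<open>R \<notin> U\<close> by blast
  ultimately have "\<forall>\<^sub>F i in F. g (f i) \<in> V"
    using topological_tendstoD V(1) by blast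
  then have "\<forall>\<^sub>F i in F. False"
    using f by eventually_elim (use V in blast)
  then show False using F by simp
qed

text \<open>The geometric series of the powers of \<open>K\<close> converges in norm; its partial
  sums lie in \<open>U\<close>, so strong closedness keeps the sum there. Telescoping gives both
  inverse identities.\<close>

lemma neumann_inverse:
  assumes K: "K \<in> U" "norm K < 1"
  shows "\<exists>N\<in>U. N \<cdot> (id_blinfun - K) = id_blinfun \<and> (id_blinfun - K) \<cdot> N = id_blinfun"
proof -
  define p where "p i = ((\<lambda>A. K \<cdot> A) ^^ i) id_blinfun" for i
  have p0: "p 0 = id_blinfun" and pS: "p (Suc i) = K \<cdot> p i" for i
    by (simp_all add: p_def)
  have pS': "p (Suc i) = p i \<cdot> K" for i
  proof (induction i)
    case (Suc i)
    then show ?case by (metis pS compose_assoc)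
  qed (simp add: p0 pS)
  have pU: "p i \<in> U" for i
    by (induction i) (simp_all add: p0 pS K)
  \<comment> \<open>\<open>norm id_blinfun\<close> is 1 except on the zero space; carrying it as a
    factor covers both cases.\<close>
  have np: "norm (p i) \<le> norm K ^ i * norm (id_blinfun :: 'h operator)" for i
  proof (induction i)
    case (Suc i)
    have "norm (p (Suc i)) \<le> norm K * norm (p i)"
      by (simp add: pS norm_blinfun_compose)
    also have "\<dots> \<le> norm K * (norm K ^ i * norm (id_blinfun :: 'h operator))"
      using Suc by (simp add: mult_left_mono)
    finally show ?case by (simp add: mult.assoc)
  qed (simp add: p0)
  have summ: "summable p"
    by (rule summable_comparison_test'[OF _ np])
      (use K in \<open>simp add: summable_geometric summable_mult2\<close>)
  define N where "N = suminf p"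
  have lim: "(\<lambda>n. \<Sum>i<n. p i) \<longlonglongrightarrow> N"
    using summ by (simp add: N_def summable_LIMSEQ)
  have "N \<in> U"
  proof (rule strong_limit_in[OF sequentially_bot])
    have "(\<Sum>i<n. p i) \<in> U" for n by (induction n) (simp_all add: pU)
    then show "\<forall>\<^sub>F n in sequentially. (\<Sum>i<n. p i) \<in> U" by simp
    show "(\<lambda>n. blinfun_apply (\<Sum>i<n. p i) x) \<longlonglongrightarrow> N x" for x
      by (rule tendsto_intros lim)+
  qed
  have pz: "p \<longlonglongrightarrow> 0" using summ by (rule summable_LIMSEQ_zero)
  have t1: "(\<Sum>i<n. p i) \<cdot> (id_blinfun - K) = id_blinfun - p n" for n
  proof (induction n)
    case (Suc n)
    have "(\<Sum>i<Suc n. p i) \<cdot> (id_blinfun - K) = (id_blinfun - p n) + p n \<cdot> (id_blinfun - K)"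
      by (simp only: sum.lessThan_Suc compose_bilinear(1) Suc)
    then show ?case by (simp add: compose_bilinear pS')
  qed (simp add: p0)
  have t2: "(id_blinfun - K) \<cdot> (\<Sum>i<n. p i) = id_blinfun - p n" for n
  proof (induction n)
    case (Suc n)
    have "(id_blinfun - K) \<cdot> (\<Sum>i<Suc n. p i) = (id_blinfun - p n) + (id_blinfun - K) \<cdot> p n"
      by (simp only: sum.lessThan_Suc compose_bilinear(2) Suc)
    then show ?case by (simp add: compose_bilinear pS)
  qed (simp add: p0)
  have "(\<lambda>n. (\<Sum>i<n. p i) \<cdot> (id_blinfun - K)) \<longlonglongrightarrow> N \<cdot> (id_blinfun - K)"
    by (rule bounded_bilinear.tendsto[OF bounded_bilinear_blinfun_compose lim tendsto_const])
  moreover have "(\<lambda>n. (\<Sum>i<n. p i) \<cdot> (id_blinfun - K)) \<longlonglongrightarrow> id_blinfun - 0"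
    unfolding t1 by (intro tendsto_intros pz)
  ultimately have 1: "N \<cdot> (id_blinfun - K) = id_blinfun"
    using LIMSEQ_unique by fastforce
  have "(\<lambda>n. (id_blinfun - K) \<cdot> (\<Sum>i<n. p i)) \<longlonglongrightarrow> (id_blinfun - K) \<cdot> N"
    by (rule bounded_bilinear.tendsto[OF bounded_bilinear_blinfun_compose tendsto_const lim])
  moreover have "(\<lambda>n. (id_blinfun - K) \<cdot> (\<Sum>i<n. p i)) \<longlonglongrightarrow> id_blinfun - 0"
    unfolding t2 by (intro tendsto_intros pz)
  ultimately have 2: "(id_blinfun - K) \<cdot> N = id_blinfun"
    using LIMSEQ_unique by fastforce
  show ?thesis using \<open>N \<in> U\<close> 1 2 by blast
qed

end

section \<open>Annihilators of ideals\<close>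

text \<open>Positivity is phrased with the real inner product; for complex-linear operators the
  symmetry clause amounts to self-adjointness by \<open>is_adjoint_if_inner\<close>.\<close>

definition positive_op :: "'h::real_inner operator \<Rightarrow> bool"
  where "positive_op S \<longleftrightarrow> (\<forall>x y. inner (S x) y = inner x (S y)) \<and> (\<forall>x. 0 \<le> inner (S x) x)"

lemma positive_op_sym: "positive_op S \<Longrightarrow> inner (S x) y = inner x (S y)"
  by (simp add: positive_op_def)

lemma positive_op_nonneg:
  assumes "positive_op S"
  shows "0 \<le> inner (S x) x" "0 \<le> inner x (S x)"
  using assms unfolding positive_op_def by metis+

lemma positive_op_add:
  assumes "positive_op S" "positive_op T" shows "positive_op (S + T)"
  unfolding positive_op_def
  by (simp add: blinfun.add_left inner_add positive_op_sym[OF assms(1)] positive_op_sym[OF assms(2)]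
      positive_op_nonneg[OF assms(1)] positive_op_nonneg[OF assms(2)])

lemma positive_op_scaleR:
  assumes "positive_op S" "c \<ge> 0" shows "positive_op (c *\<^sub>R S)"
  unfolding positive_op_def
  by (simp add: blinfun.scaleR_left positive_op_sym[OF assms(1)] positive_op_nonneg[OF assms(1)] assms(2))

text \<open>Positivity of \<open>D\<close> is evaluated at \<open>x - D x\<close>, and the resulting
  term \<open>inner (D (D x)) (D x)\<close> is at most \<open>(norm (D x))\<^sup>2\<close>. This is
  \<open>D\<^sup>2 \<le> D\<close> for \<open>0 \<le> D \<le> 1\<close>.\<close>

lemma positive_contraction_norm:
  assumes "positive_op D" and "\<And>x. inner (D x) x \<le> (norm x)\<^sup>2"
  shows "(norm (D x))\<^sup>2 \<le> inner (D x) x"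
proof -
  have "0 \<le> inner (D (x - D x)) (x - D x)"
    by (rule positive_op_nonneg[OF assms(1)])
  also have "\<dots> = inner (D x) x - 2 * (norm (D x))\<^sup>2 + inner (D (D x)) (D x)"
    by (simp add: positive_op_sym[OF assms(1)] blinfun.diff_right inner_diff power2_norm_eq_inner)
  finally show ?thesis using assms(2)[of "D x"] by linarith
qed

lemma projection_op_inner:
  assumes "projection_op R"
  shows "inner (R x) x = (norm (R x))\<^sup>2"
proof -
  have "R (R x) = R x"
    using assms unfolding projection_op_def by (metis blinfun_apply_blinfun_compose)
  moreover have "inner (R (R x)) x = inner (R x) (R x)"
    using assms is_adjoint_inner[of R R "R x" x] by (simp add: projection_op_def selfadjoint_op_def)
  ultimately show ?thesis by (simp add: power2_norm_eq_inner)
qed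

section \<open>Resolvents of positive elements\<close>

context von_neumann
begin

text \<open>For \<open>S \<ge> 0\<close> and \<open>c \<ge> \<parallel>S\<parallel>\<close>, the operator \<open>(c - S) / (1 + c)\<close> is a strict contraction, which gives
  the inverse of \<open>1 + S\<close> as a Neumann series.\<close>

lemma resolvent_exists:
  assumes S: "S \<in> U" "positive_op S"
  shows "\<exists>N\<in>U. N \<cdot> (id_blinfun + S) = id_blinfun \<and> (id_blinfun + S) \<cdot> N = id_blinfun"
proof -
  define c where "c = norm S + 1"
  have c: "c > 0" "norm S \<le> c" by (simp_all add: c_def add_nonneg_pos)
  define D where "D = id_blinfun - (1 / c) *\<^sub>R S"
  have Dx: "inner (D x) x = (norm x)\<^sup>2 - inner (S x) x / c" for x
    by (simp add: D_def blinfun.diff_left blinfun.scaleR_left inner_diff_left power2_norm_eq_inner)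
  have up: "inner (S x) x \<le> c * (norm x)\<^sup>2" for x
  proof -
    have "inner (S x) x \<le> norm (S x) * norm x" by (rule norm_cauchy_schwarz)
    also have "\<dots> \<le> (norm S * norm x) * norm x" by (simp add: mult_right_mono norm_blinfun)
    also have "\<dots> \<le> c * (norm x)\<^sup>2"
      using c by (simp add: power2_eq_square mult_right_mono mult.assoc[symmetric])
    finally show ?thesis .
  qed
  have "positive_op D"
    unfolding positive_op_def
  proof (intro conjI allI)
    show "inner (D x) y = inner x (D y)" for x y
      by (simp add: D_def positive_op_sym[OF S(2)] blinfun.diff_left blinfun.scaleR_left inner_diff)
    show "0 \<le> inner (D x) x" for x
      using up[of x] c by (simp add: Dx field_simps)
  qed
  moreover have "inner (D x) x \<le> (norm x)\<^sup>2" for x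
    using positive_op_nonneg[OF S(2)] c by (simp add: Dx)
  ultimately have "(norm (D x))\<^sup>2 \<le> (norm x)\<^sup>2" for x
    using positive_contraction_norm[of D x] order_trans by blast
  then have "norm (D x) \<le> norm x" for x
    by (simp add: power2_le_iff_abs_le)
  then have nD: "norm D \<le> 1" by (intro norm_blinfun_bound) auto
  define K where "K = (c / (1 + c)) *\<^sub>R D"
  have "norm K = c / (1 + c) * norm D" using c by (simp add: K_def)
  also have "\<dots> \<le> c / (1 + c) * 1" using c nD by (intro mult_left_mono) auto
  also have "\<dots> < 1" using c by simp
  finally have "norm K < 1" .
  moreover have "K \<in> U" by (simp add: K_def D_def S)
  ultimately obtain N where N: "N \<in> U" "N \<cdot> (id_blinfun - K) = id_blinfun"
    "(id_blinfun - K) \<cdot> N = id_blinfun"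
    using neumann_inverse by blast
  have eq: "id_blinfun - K = (1 / (1 + c)) *\<^sub>R (id_blinfun + S)"
  proof -
    have "(1 + c) *\<^sub>R K = c *\<^sub>R D" "c *\<^sub>R D = c *\<^sub>R id_blinfun - S"
      using c by (simp_all add: K_def D_def scaleR_diff_right)
    then have "(1 + c) *\<^sub>R (id_blinfun - K) = id_blinfun + S"
      by (simp add: scaleR_diff_right scaleR_add_left)
    then have "(1 / (1 + c)) *\<^sub>R (id_blinfun + S) = (1 / (1 + c)) *\<^sub>R ((1 + c) *\<^sub>R (id_blinfun - K))"
      by simp
    then show ?thesis using c by simp
  qed
  let ?N = "(1 / (1 + c)) *\<^sub>R N"
  have "?N \<cdot> (id_blinfun + S) = id_blinfun" "(id_blinfun + S) \<cdot> ?N = id_blinfun"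
    using N(2,3) unfolding eq
    by (simp_all add: bounded_bilinear.scaleR_left[OF bounded_bilinear_blinfun_compose]
        bounded_bilinear.scaleR_right[OF bounded_bilinear_blinfun_compose])
  then show ?thesis using N(1) by blast
qed

text \<open>Two-sided inverses are unique, so for positive \<open>S\<close> in \<open>U\<close> the
  choice has a single candidate.\<close>

definition resolvent :: "'h operator \<Rightarrow> 'h operator" where
  "resolvent S = (SOME N. N \<in> U \<and> N \<cdot> (id_blinfun + S) = id_blinfun \<and> (id_blinfun + S) \<cdot> N = id_blinfun)"

context
  fixes S :: "'h operator"
  assumes S: "S \<in> U" "positive_op S"
begin

lemma resolvent:
  "resolvent S \<in> U" "resolvent S \<cdot> (id_blinfun + S) = id_blinfun"
  "(id_blinfun + S) \<cdot> resolvent S = id_blinfun"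
  using someI_ex[of "\<lambda>N. N \<in> U \<and> N \<cdot> (id_blinfun + S) = id_blinfun \<and> (id_blinfun + S) \<cdot> N = id_blinfun"]
    resolvent_exists[OF S] unfolding resolvent_def by blast+

lemma resolvent_apply: "resolvent S x + S (resolvent S x) = x"
  using arg_cong[OF resolvent(3), of "\<lambda>A. blinfun_apply A x"] by (simp add: blinfun.add_left)

text \<open>This form shows that \<open>id_blinfun - resolvent S\<close> lies in every two-sided
  ideal containing \<open>S\<close>.\<close>

lemma one_minus_resolvent: "id_blinfun - resolvent S = S \<cdot> resolvent S"
  using resolvent(3) by (simp add: compose_bilinear diff_eq_eq add.commute)

lemma resolvent_symmetric: "inner (resolvent S x) y = inner x (resolvent S y)"
proof -
  let ?u = "resolvent S x" and ?v = "resolvent S y"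
  have "inner ?u (?v + S ?v) = inner (?u + S ?u) ?v"
    using S by (simp add: positive_op_def inner_add)
  then show ?thesis by (simp only: resolvent_apply)
qed

text \<open>Obtained by writing \<open>x\<close> as \<open>1 + S\<close> applied to the resolvent
  vector. Positivity, the contraction property and a bound on the form of \<open>S\<close> at that
  vector are read off from it.\<close>

lemma resolvent_form: "inner (resolvent S x) x = (norm (resolvent S x))\<^sup>2 + inner (S (resolvent S x)) (resolvent S x)"
proof -
  have "inner (resolvent S x) x = inner (resolvent S x) (resolvent S x + S (resolvent S x))"
    by (simp only: resolvent_apply)
  then show ?thesis by (simp add: inner_add power2_norm_eq_inner inner_commute)
qed

lemma resolvent_positive: "positive_op (resolvent S)"
  unfolding positive_op_def
proof (intro conjI allI resolvent_symmetric)
  show "0 \<le> inner (resolvent S x) x" for x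
    unfolding resolvent_form by (intro add_nonneg_nonneg zero_le_power2 positive_op_nonneg[OF S(2)])
qed

lemma resolvent_contraction: "norm (resolvent S x) \<le> norm x"
proof -
  have "(norm (resolvent S x))\<^sup>2 \<le> inner (resolvent S x) x"
    by (simp add: resolvent_form positive_op_nonneg[OF S(2)])
  also have "\<dots> \<le> norm (resolvent S x) * norm x" by (rule norm_cauchy_schwarz)
  finally have "norm (resolvent S x) * norm (resolvent S x) \<le> norm (resolvent S x) * norm x"
    by (simp add: power2_eq_square)
  then show ?thesis
    by (cases "norm (resolvent S x) = 0") (auto simp: mult_le_cancel_left)
qed

lemma resolvent_form_le: "inner (resolvent S x) x \<le> (norm x)\<^sup>2"
proof -
  have "inner (resolvent S x) x \<le> norm (resolvent S x) * norm x" by (rule norm_cauchy_schwarz)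
  also have "\<dots> \<le> (norm x)\<^sup>2"
    by (simp add: power2_eq_square mult_right_mono resolvent_contraction)
  finally show ?thesis .
qed

end

text \<open>With \<open>u\<close> and \<open>v\<close> the two resolvent vectors, the positive form
  of \<open>1 + S\<close> is evaluated at \<open>u - v\<close>. Replacing
  \<open>inner (S v) v\<close> by the larger \<open>inner (T v) v\<close> and inserting
  \<open>S u = x - u\<close> and \<open>T v = x - v\<close> leaves the difference of the two
  sides.\<close>

lemma resolvent_antimono:
  assumes S: "S \<in> U" "positive_op S" and T: "T \<in> U" "positive_op T"
    and le: "\<And>x. inner (S x) x \<le> inner (T x) x"
  shows "inner (resolvent T x) x \<le> inner (resolvent S x) x"
proof -
  let ?u = "resolvent S x" and ?v = "resolvent T x"
  have sym: "inner (S a) b = inner (S b) a" for a b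
    using S by (metis positive_op_def inner_commute)
  have u: "S ?u = x - ?u" using resolvent_apply[OF S, of x] by (metis add_diff_cancel_left')
  have v: "T ?v = x - ?v" using resolvent_apply[OF T, of x] by (metis add_diff_cancel_left')
  have "0 \<le> inner (?u - ?v) (?u - ?v) + inner (S (?u - ?v)) (?u - ?v)"
    by (intro add_nonneg_nonneg inner_ge_zero positive_op_nonneg[OF S(2)])
  also have "inner (S (?u - ?v)) (?u - ?v) =
      inner (S ?u) ?u - 2 * inner (S ?u) ?v + inner (S ?v) ?v"
    by (simp add: blinfun.diff_right inner_diff sym[of ?v ?u])
  also have "\<dots> \<le> inner (S ?u) ?u - 2 * inner (S ?u) ?v + inner (T ?v) ?v"
    using le by simp
  finally show ?thesis
    unfolding u v by (simp add: inner_diff inner_commute)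
qed

text \<open>The difference of the resolvents lies between 0 and 1, so
  \<open>positive_contraction_norm\<close> applies. Monotone convergence of quadratic forms thereby
  becomes convergence of vectors.\<close>

lemma resolvent_dist:
  assumes S: "S \<in> U" "positive_op S" and T: "T \<in> U" "positive_op T"
    and le: "\<And>x. inner (S x) x \<le> inner (T x) x"
  shows "(norm (resolvent S x - resolvent T x))\<^sup>2 \<le> inner (resolvent S x) x - inner (resolvent T x) x"
proof -
  let ?D = "resolvent S - resolvent T"
  have "positive_op ?D"
    using resolvent_antimono[OF assms, unfolded resolvent_symmetric[OF S] resolvent_symmetric[OF T]]
    by (simp add: positive_op_def blinfun.diff_left inner_diff
        resolvent_symmetric[OF S] resolvent_symmetric[OF T])
  moreover have "inner (?D y) y \<le> (norm y)\<^sup>2" for y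
    using resolvent_form_le[OF S, of y] positive_op_nonneg(1)[OF resolvent_positive[OF T], of y]
    by (simp add: blinfun.diff_left inner_diff)
  ultimately show ?thesis
    using positive_contraction_norm[of ?D x] by (simp add: blinfun.diff_left inner_diff)
qed

end

section \<open>The resolvent net of a two-sided ideal\<close>

locale two_sided_ideal = von_neumann U for U :: "'h::complex_hilbert operator set" +
  fixes J :: "'h operator set"
  assumes J_subset: "J \<subseteq> U" and J_zero: "0 \<in> J" and J_add: "\<And>A B. A \<in> J \<Longrightarrow> B \<in> J \<Longrightarrow> A + B \<in> J"
    and J_left: "\<And>A B. A \<in> U \<Longrightarrow> B \<in> J \<Longrightarrow> A \<cdot> B \<in> J"
    and J_right: "\<And>A B. A \<in> J \<Longrightarrow> B \<in> U \<Longrightarrow> A \<cdot> B \<in> J"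
begin

definition J_pos where "J_pos = {S \<in> J. positive_op S}"

lemma J_posD: "S \<in> J_pos \<Longrightarrow> S \<in> U" "S \<in> J_pos \<Longrightarrow> positive_op S"
  using J_subset by (auto simp: J_pos_def)

definition tail :: "'h operator \<Rightarrow> 'h operator set"
  where "tail S = {T \<in> J_pos. \<forall>x. inner (S x) x \<le> inner (T x) x}"

text \<open>The section filter of \<open>J_pos\<close>, directed by the order of quadratic forms, so
  that a limit along it is the limit of a net.\<close>

definition net where "net = (INF S\<in>J_pos. principal (tail S))"

lemma zero_J_pos: "0 \<in> J_pos"
  by (simp add: J_pos_def J_zero positive_op_def)

text \<open>The index set is upward directed because \<open>A + B\<close> dominates both
  \<open>A\<close> and \<open>B\<close>; \<open>0\<close> makes it nonempty.\<close>

lemma eventually_net: "eventually Q net \<longleftrightarrow> (\<exists>S\<in>J_pos. \<forall>T\<in>tail S. Q T)"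
proof -
  have "\<exists>S\<in>J_pos. principal (tail S) \<le> inf (principal (tail A)) (principal (tail B))"
    if "A \<in> J_pos" "B \<in> J_pos" for A B
  proof (intro bexI[of _ "A + B"])
    show "A + B \<in> J_pos" using that by (simp add: J_pos_def J_add positive_op_add)
    have "inner (A x) x \<le> inner ((A + B) x) x" "inner (B x) x \<le> inner ((A + B) x) x" for x
      using positive_op_nonneg(1)[of A x] positive_op_nonneg(1)[of B x] that
      by (simp_all add: J_pos_def blinfun.add_left inner_add_left)
    then show "principal (tail (A + B)) \<le> inf (principal (tail A)) (principal (tail B))"
      by (auto simp: tail_def intro: order_trans)
  qed
  then show ?thesis
    unfolding net_def using zero_J_pos
    by (subst eventually_INF_base) (auto simp: eventually_principal)
qed

lemma tail_refl: "S \<in> J_pos \<Longrightarrow> S \<in> tail S"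
  by (simp add: tail_def)

lemma net_not_bot: "net \<noteq> bot"
  using tail_refl unfolding trivial_limit_def eventually_net by blast

lemma eventually_J_pos: "\<forall>\<^sub>F S in net. S \<in> J_pos"
  unfolding eventually_net using zero_J_pos by (auto simp: tail_def)

text \<open>The quadratic forms at \<open>x\<close> decrease and are bounded below by 0. An index
  \<open>S\<close> whose value is within \<open>e\<^sup>2\<close> of the infimum controls all later
  indices through \<open>resolvent_dist\<close>.\<close>

lemma resolvent_net_converges: "\<exists>l. ((\<lambda>S. resolvent S x) \<longlongrightarrow> l) net"
proof (rule convergent_if_eventually_close[OF net_not_bot])
  fix e :: real assume "e > 0"
  let ?a = "\<lambda>S. inner (resolvent S x) x"
  have nonneg: "0 \<le> ?a S" if "S \<in> J_pos" for S
    by (rule positive_op_nonneg(1)[OF resolvent_positive[OF J_posD[OF that]]])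
  define m where "m = Inf (?a ` J_pos)"
  have bdd: "bdd_below (?a ` J_pos)" by (rule bdd_belowI[of _ 0]) (use nonneg in auto)
  have "\<exists>S\<in>J_pos. ?a S < m + e\<^sup>2"
    using cInf_lessD[of "?a ` J_pos" "m + e\<^sup>2"] zero_J_pos \<open>e > 0\<close> by (auto simp: m_def)
  then obtain S where S: "S \<in> J_pos" "?a S < m + e\<^sup>2" by blast
  have "dist (resolvent T x) (resolvent S x) < e" if "T \<in> tail S" for T
  proof -
    have T: "T \<in> J_pos" "\<And>x. inner (S x) x \<le> inner (T x) x" using that by (auto simp: tail_def)
    have "m \<le> ?a T" unfolding m_def using bdd T by (intro cInf_lower) auto
    then have "(norm (resolvent S x - resolvent T x))\<^sup>2 < e\<^sup>2"
      using resolvent_dist[OF J_posD[OF S(1)] J_posD[OF T(1)] T(2), of x] S(2) by linarith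
    then show ?thesis
      using \<open>e > 0\<close> by (simp add: dist_norm norm_minus_commute power_less_imp_less_base)
  qed
  then show "\<exists>y. \<forall>\<^sub>F T in net. dist (resolvent T x) y < e"
    unfolding eventually_net using S(1) by blast
qed

lemma complement_in_J: assumes "S \<in> J_pos" shows "id_blinfun - resolvent S \<in> J"
  using assms one_minus_resolvent[OF J_posD[OF assms]] resolvent(1)[OF J_posD[OF assms]]
  by (simp add: J_pos_def J_right)

lemma gram_in_J_pos:
  assumes j: "j \<in> J" and B: "B \<in> U" "is_adjoint j B" and "t \<ge> 0"
  shows "t *\<^sub>R (B \<cdot> j) \<in> J_pos"
proof -
  have "inner (B (j x)) y = inner (j x) (j y)" for x y
    using is_adjoint_inner[OF is_adjoint_sym[OF B(2)]] .
  moreover have "inner x (B (j y)) = inner (j x) (j y)" for x y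
    using is_adjoint_inner[OF B(2)] by simp
  ultimately have "positive_op (B \<cdot> j)"
    by (simp add: positive_op_def)
  then have "positive_op (t *\<^sub>R (B \<cdot> j))"
    using \<open>t \<ge> 0\<close> by (rule positive_op_scaleR)
  \<comment> \<open>Closure of \<open>J\<close> under scalars comes from its closure under
    multiplication by \<open>U\<close>: the scalar is absorbed into a multiple of the
    identity.\<close>
  moreover have "t *\<^sub>R (B \<cdot> j) = (t *\<^sub>R id_blinfun) \<cdot> (B \<cdot> j)"
    by (rule blinfun_eqI) (simp add: blinfun.scaleR_left)
  moreover have "(t *\<^sub>R id_blinfun) \<cdot> (B \<cdot> j) \<in> J"
    using j B by (intro J_left) auto
  ultimately show ?thesis by (simp add: J_pos_def)
qed

text \<open>Once \<open>T\<close> dominates \<open>t\<close> times the Gram operator of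
  \<open>j\<close>, the number \<open>t * (norm (j y))\<^sup>2\<close> at
  \<open>y = resolvent T x\<close> is bounded by the form of \<open>T\<close> at \<open>y\<close>,
  hence by \<open>(norm x)\<^sup>2\<close>, whatever \<open>T\<close> is. A large \<open>t\<close>
  forces \<open>j y\<close> to be small.\<close>

lemma J_resolvent_tendsto_0:
  assumes j: "j \<in> J" shows "((\<lambda>S. j (resolvent S x)) \<longlongrightarrow> 0) net"
proof (rule tendstoI)
  fix e :: real assume "e > 0"
  obtain B where B: "B \<in> U" "is_adjoint j B" using adjoint_in j J_subset by blast
  \<comment> \<open>Chosen so that \<open>t * e\<^sup>2\<close> exceeds
    \<open>(norm x)\<^sup>2\<close>; the summand 1 keeps \<open>t\<close> positive when
    \<open>x = 0\<close>.\<close>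
  define t where "t = ((norm x)\<^sup>2 + 1) / e\<^sup>2"
  have t: "t > 0" using \<open>e > 0\<close> by (simp add: t_def add_nonneg_pos)
  let ?S = "t *\<^sub>R (B \<cdot> j)"
  have "dist (j (resolvent T x)) 0 < e" if "T \<in> tail ?S" for T
  proof -
    have T: "T \<in> J_pos" and le: "inner (?S y) y \<le> inner (T y) y" for y
      using that by (auto simp: tail_def)
    let ?y = "resolvent T x"
    have "inner (?S ?y) ?y = t * (norm (j ?y))\<^sup>2"
      using is_adjoint_inner[OF is_adjoint_sym[OF B(2)], of "j ?y" ?y]
      by (simp add: blinfun.scaleR_left power2_norm_eq_inner)
    then have "t * (norm (j ?y))\<^sup>2 \<le> inner (T ?y) ?y" using le[of ?y] by simp
    also have "\<dots> \<le> inner ?y x" by (simp add: resolvent_form[OF J_posD[OF T]])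
    also have "\<dots> < (norm x)\<^sup>2 + 1"
      using resolvent_form_le[OF J_posD[OF T], of x] by simp
    also have "\<dots> = t * e\<^sup>2" using \<open>e > 0\<close> by (simp add: t_def)
    finally have "(norm (j ?y))\<^sup>2 < e\<^sup>2" using t by simp
    then show ?thesis using \<open>e > 0\<close> by (simp add: power_less_imp_less_base)
  qed
  then show "\<forall>\<^sub>F T in net. dist (j (resolvent T x)) 0 < e"
    unfolding eventually_net using gram_in_J_pos[OF j B, of t] t by (metis less_imp_le)
qed

text \<open>Each \<open>id_blinfun - resolvent S\<close> lies in the ideal, and elements of the
  ideal kill the range of the strong limit \<open>R\<close>. Hence the resolvents fix every vector
  \<open>A (R x)\<close>, and \<open>R A R = A R\<close> in the limit. With self-adjointness this
  makes \<open>R\<close> idempotent and central.\<close>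

lemma annihilator_projection:
  "\<exists>R. central_projection U R \<and> (\<forall>j\<in>J. j \<cdot> R = 0) \<and> (\<forall>x. ((\<lambda>S. resolvent S x) \<longlongrightarrow> R x) net)"
proof -
  have "\<forall>\<^sub>F S in net. norm (resolvent S) \<le> 1"
    using eventually_J_pos
    by eventually_elim (auto intro!: norm_blinfun_bound simp: resolvent_contraction J_posD)
  then obtain R where lim: "\<And>x. ((\<lambda>S. resolvent S x) \<longlongrightarrow> blinfun_apply R x) net"
    using strong_limit_exists[OF net_not_bot _ resolvent_net_converges] by blast
  have RU: "R \<in> U"
  proof (rule strong_limit_in[OF net_not_bot _ lim])
    show "\<forall>\<^sub>F S in net. resolvent S \<in> U"
      using eventually_J_pos by eventually_elim (simp add: resolvent J_posD)
  qed
  have jR: "j \<cdot> R = 0" if "j \<in> J" for j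
  proof (rule blinfun_eqI)
    fix x
    have "((\<lambda>S. j (resolvent S x)) \<longlongrightarrow> j (R x)) net"
      by (rule blinfun.tendsto[OF tendsto_const lim])
    from tendsto_unique[OF net_not_bot this J_resolvent_tendsto_0[OF that]]
    show "blinfun_apply (j \<cdot> R) x = blinfun_apply 0 x" by simp
  qed
  have sym: "inner (R x) y = inner x (R y)" for x y
  proof (rule tendsto_unique[OF net_not_bot])
    show "((\<lambda>S. inner (resolvent S x) y) \<longlongrightarrow> inner (R x) y) net"
      by (rule tendsto_inner[OF lim tendsto_const])
    have "((\<lambda>S. inner x (resolvent S y)) \<longlongrightarrow> inner x (R y)) net"
      by (rule tendsto_inner[OF tendsto_const lim])
    moreover have "\<forall>\<^sub>F S in net. inner x (resolvent S y) = inner (resolvent S x) y"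
      using eventually_J_pos
    proof eventually_elim
      case (elim S)
      show ?case by (rule resolvent_symmetric[OF J_posD[OF elim], symmetric])
    qed
    ultimately show "((\<lambda>S. inner (resolvent S x) y) \<longlongrightarrow> inner x (R y)) net"
      by (rule Lim_transform_eventually)
  qed
  have adj: "is_adjoint R R"
    using is_adjoint_if_inner[OF complex_linear[OF RU] sym] .
  have fix_R: "R (A (R x)) = A (R x)" if "A \<in> U" for A x
  proof -
    have "\<forall>\<^sub>F S in net. resolvent S (A (R x)) = A (R x)"
      using eventually_J_pos
    proof eventually_elim
      case (elim S)
      have "(id_blinfun - resolvent S) \<cdot> A \<cdot> R = 0"
        using complement_in_J[OF elim] that jR J_right by blast
      then have "blinfun_apply ((id_blinfun - resolvent S) \<cdot> A \<cdot> R) x = 0" by simp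
      then show ?case by (simp add: blinfun.diff_left)
    qed
    then have "((\<lambda>S. A (R x)) \<longlongrightarrow> R (A (R x))) net"
      by (rule Lim_transform_eventually[OF lim])
    then show ?thesis by (rule tendsto_unique[OF net_not_bot _ tendsto_const])
  qed
  \<comment> \<open>The identity \<open>R B R = B R\<close> for the adjoint \<open>B\<close> of
    \<open>A\<close>, moved across the inner product, becomes \<open>R A = R A R\<close>.\<close>
  have comm: "R \<cdot> A = A \<cdot> R" if A: "A \<in> U" for A
  proof (rule blinfun_eqI)
    fix x
    obtain B where B: "B \<in> U" "is_adjoint A B" using adjoint_in A by blast
    have "inner (R (A x)) y = inner (A (R x)) y" for y
    proof -
      have "inner (R (A x)) y = inner x (B (R y))"
        unfolding sym is_adjoint_inner[OF B(2)] ..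
      also have "\<dots> = inner x (R (B (R y)))" by (simp add: fix_R[OF B(1)])
      also have "\<dots> = inner (R (A (R x))) y"
        unfolding sym[symmetric, of x] is_adjoint_inner[OF B(2), symmetric] sym ..
      finally show ?thesis by (simp add: fix_R[OF A])
    qed
    then have "R (A x) = A (R x)"
      using vector_eq_rdot by blast
    then show "blinfun_apply (R \<cdot> A) x = blinfun_apply (A \<cdot> R) x"
      by simp
  qed
  have "R \<cdot> R = R"
    by (rule blinfun_eqI) (use fix_R[OF id_in] in simp)
  then have "central_projection U R"
    using RU comm adj unfolding central_projection_def center_def projection_op_def selfadjoint_op_def
    by blast
  then show ?thesis using jR lim by blast
qed

end

section \<open>The center of a corner\<close>

text \<open>The list holds the outer factors, so that one list can be evaluated both at
  \<open>e\<close> and at a central element \<open>z\<close> of the corner; the values at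
  \<open>e\<close> make up the ideal generated by \<open>e\<close>.\<close>

definition sandwich :: "('h::real_normed_vector operator \<times> 'h operator) list \<Rightarrow> 'h operator \<Rightarrow> 'h operator"
  where "sandwich L z = (\<Sum>(A, B)\<leftarrow>L. A \<cdot> z \<cdot> B)"

lemma sandwich_simps [simp]:
  "sandwich [] z = 0"
  "sandwich ((A, B) # L) z = A \<cdot> z \<cdot> B + sandwich L z"
  "sandwich (L @ M) z = sandwich L z + sandwich M z"
  by (simp_all add: sandwich_def)

lemma sandwich_left: "sandwich (map (\<lambda>(A, B). (C \<cdot> A, B)) L) z = C \<cdot> sandwich L z"
  by (induction L) (auto simp: compose_bilinear compose_assoc)

lemma sandwich_right: "sandwich (map (\<lambda>(A, B). (A, B \<cdot> C)) L) z = sandwich L z \<cdot> C"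
  by (induction L) (auto simp: compose_bilinear compose_assoc)

lemma sandwich_norm_le: "norm (sandwich L z) \<le> (\<Sum>(A, B)\<leftarrow>L. norm A * norm B) * norm z"
proof (induction L)
  case (Cons a L)
  obtain A B where a: "a = (A, B)" by (cases a)
  have "norm (A \<cdot> z \<cdot> B) \<le> norm (A \<cdot> z) * norm B" by (rule norm_blinfun_compose)
  also have "\<dots> \<le> norm A * norm z * norm B"
    by (intro mult_right_mono norm_blinfun_compose norm_ge_zero)
  finally have "norm (A \<cdot> z \<cdot> B) \<le> norm A * norm B * norm z" by (simp add: ac_simps)
  then show ?case
    using Cons norm_triangle_le[of "A \<cdot> z \<cdot> B" "sandwich L z"] by (simp add: a distrib_right)
qed simp

context von_neumann
begin

text \<open>The center of the algebra \<open>e U e\<close>, with its elements kept as operators on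
  the whole space.\<close>

definition corner_center :: "'h operator \<Rightarrow> 'h operator set" where
  "corner_center e = {z \<in> U. e \<cdot> z = z \<and> z \<cdot> e = z \<and> (\<forall>A\<in>U. z \<cdot> (e \<cdot> A \<cdot> e) = (e \<cdot> A \<cdot> e) \<cdot> z)}"

lemma corner_centerD:
  assumes "z \<in> corner_center e"
  shows "z \<in> U" "e \<cdot> z = z" "z \<cdot> e = z" "A \<in> U \<Longrightarrow> z \<cdot> (e \<cdot> A \<cdot> e) = (e \<cdot> A \<cdot> e) \<cdot> z"
  using assms by (auto simp: corner_center_def)

lemma is_adjoint_compose: "is_adjoint A B \<Longrightarrow> is_adjoint C D \<Longrightarrow> is_adjoint (A \<cdot> C) (D \<cdot> B)"
  by (simp add: is_adjoint_def)

lemma is_adjoint_unique: "is_adjoint A B \<Longrightarrow> is_adjoint A C \<Longrightarrow> B = C"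
  by (metis is_adjoint_inner blinfun_eqI vector_eq_ldot)

lemma corner_center_adjoint:
  assumes e: "projection_op e" and z: "z \<in> corner_center e" and w: "w \<in> U" "is_adjoint z w"
  shows "w \<in> corner_center e"
proof -
  have ee: "is_adjoint e e" using e by (simp add: projection_op_def selfadjoint_op_def)
  have 1: "w \<cdot> e = w"
    using is_adjoint_unique[OF is_adjoint_compose[OF ee w(2)]] w(2) corner_centerD(2)[OF z] by simp
  have 2: "e \<cdot> w = w"
    using is_adjoint_unique[OF is_adjoint_compose[OF w(2) ee]] w(2) corner_centerD(3)[OF z] by simp
  have "w \<cdot> (e \<cdot> A \<cdot> e) = (e \<cdot> A \<cdot> e) \<cdot> w" if "A \<in> U" for A
  proof -
    obtain B where B: "B \<in> U" "is_adjoint A B" using adjoint_in \<open>A \<in> U\<close> by blast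
    have ad: "is_adjoint (e \<cdot> B \<cdot> e) (e \<cdot> A \<cdot> e)"
      using is_adjoint_compose[OF is_adjoint_compose[OF ee is_adjoint_sym[OF B(2)]] ee]
      by (simp add: compose_assoc)
    show ?thesis
      using is_adjoint_unique[OF is_adjoint_compose[OF ad w(2)]] is_adjoint_compose[OF w(2) ad]
        corner_centerD(4)[OF z B(1)] by simp
  qed
  then show ?thesis using 1 2 w by (simp add: corner_center_def)
qed

lemma corner_center_compose:
  assumes w: "w \<in> corner_center e" and z: "z \<in> corner_center e"
  shows "w \<cdot> z \<in> corner_center e"
proof -
  have "w \<cdot> z \<cdot> (e \<cdot> A \<cdot> e) = (e \<cdot> A \<cdot> e) \<cdot> (w \<cdot> z)" if "A \<in> U" for A
  proof -
    have "w \<cdot> z \<cdot> (e \<cdot> A \<cdot> e) = w \<cdot> (e \<cdot> A \<cdot> e) \<cdot> z"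
      by (simp only: compose_assoc[of w] corner_centerD(4)[OF z that])
    then show ?thesis by (simp only: compose_assoc[of _ w] corner_centerD(4)[OF w that])
  qed
  moreover have "e \<cdot> (w \<cdot> z) = w \<cdot> z"
    by (simp only: compose_assoc[symmetric] corner_centerD(2)[OF w])
  moreover have "w \<cdot> z \<cdot> e = w \<cdot> z"
    by (simp only: compose_assoc corner_centerD(3)[OF z])
  ultimately show ?thesis
    using corner_centerD(1)[OF w] corner_centerD(1)[OF z] by (simp add: corner_center_def)
qed

lemma corner_center_scaleR: "z \<in> corner_center e \<Longrightarrow> c *\<^sub>R z \<in> corner_center e"
  by (simp add: corner_center_def bounded_bilinear.scaleR_left[OF bounded_bilinear_blinfun_compose]
        bounded_bilinear.scaleR_right[OF bounded_bilinear_blinfun_compose])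

lemma adjoint_norm_le:
  assumes "is_adjoint z w" shows "norm w \<le> norm z"
proof (rule norm_blinfun_bound)
  fix y
  have "(norm (w y))\<^sup>2 = inner (z (w y)) y"
    by (simp add: is_adjoint_inner[OF assms] power2_norm_eq_inner)
  also have "\<dots> \<le> norm (z (w y)) * norm y" by (rule norm_cauchy_schwarz)
  also have "\<dots> \<le> norm z * norm (w y) * norm y" by (simp add: mult_right_mono norm_blinfun)
  finally have "norm (w y) * norm (w y) \<le> norm (w y) * (norm z * norm y)"
    by (simp add: power2_eq_square ac_simps)
  then show "norm (w y) \<le> norm z * norm y"
    by (cases "norm (w y) = 0") (auto simp: mult_le_cancel_left)
qed simp

text \<open>In each pair of terms the outer factors combine to an element \<open>e A' C e\<close> of
  the corner, with which \<open>z\<close> commutes. The second \<open>z\<close> thus reaches the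
  front of its argument and crosses the inner product as its adjoint \<open>w\<close>.\<close>

lemma sandwich_inner:
  assumes e: "projection_op e" "e \<in> U" and z: "z \<in> corner_center e" and w: "w \<in> U" "is_adjoint z w"
    and L: "set L \<subseteq> U \<times> U" and M: "set M \<subseteq> U \<times> U"
  shows "inner (sandwich L z x) (sandwich M z y) = inner (sandwich L (w \<cdot> z) x) (sandwich M e y)"
proof -
  have wc: "w \<in> corner_center e" by (rule corner_center_adjoint[OF e(1) z w])
  have ee: "is_adjoint e e" "e \<cdot> e = e" using e by (auto simp: projection_op_def selfadjoint_op_def)
  have single: "inner ((A \<cdot> z \<cdot> B) x) ((C \<cdot> z \<cdot> D) y) = inner ((A \<cdot> (w \<cdot> z) \<cdot> B) x) ((C \<cdot> e \<cdot> D) y)"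
    if "A \<in> U" "C \<in> U" for A B C D
  proof -
    obtain A' where A': "A' \<in> U" "is_adjoint A A'" using adjoint_in[OF \<open>A \<in> U\<close>] by auto
    \<comment> \<open>Copies of \<open>e\<close> are inserted so that \<open>A' \<cdot> C\<close>
      appears between two of them.\<close>
    have absorb: "F \<cdot> e \<cdot> z = F \<cdot> z" for F
      by (simp only: compose_assoc corner_centerD(2)[OF z])
    have "inner ((A \<cdot> z \<cdot> B) x) ((C \<cdot> z \<cdot> D) y) = inner ((A \<cdot> e \<cdot> z \<cdot> B) x) ((C \<cdot> e \<cdot> z \<cdot> D) y)"
      by (simp only: absorb)
    also have "\<dots> = inner ((z \<cdot> B) x) ((e \<cdot> (A' \<cdot> C) \<cdot> e \<cdot> z \<cdot> D) y)"
      by (simp add: is_adjoint_inner[OF A'(2)] is_adjoint_inner[OF ee(1)])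
    also have "\<dots> = inner ((z \<cdot> B) x) ((z \<cdot> (e \<cdot> (A' \<cdot> C) \<cdot> e) \<cdot> D) y)"
      using that A' by (simp only: corner_centerD(4)[OF z] compose_in)
    also have "\<dots> = inner ((e \<cdot> (w \<cdot> z) \<cdot> B) x) ((A' \<cdot> C \<cdot> e \<cdot> D) y)"
      by (simp add: is_adjoint_inner[OF ee(1)] is_adjoint_inner[OF is_adjoint_sym[OF w(2)]])
    also have "e \<cdot> (w \<cdot> z) = w \<cdot> z"
      by (simp only: compose_assoc[symmetric] corner_centerD(2)[OF wc])
    also have "inner ((w \<cdot> z \<cdot> B) x) ((A' \<cdot> C \<cdot> e \<cdot> D) y) = inner ((A \<cdot> (w \<cdot> z) \<cdot> B) x) ((C \<cdot> e \<cdot> D) y)"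
      by (simp add: is_adjoint_inner[OF A'(2)])
    finally show ?thesis .
  qed
  have row: "inner (sandwich L z x) ((C \<cdot> z \<cdot> D) y) = inner (sandwich L (w \<cdot> z) x) ((C \<cdot> e \<cdot> D) y)"
    if "C \<in> U" for C D
    using L
  proof (induction L)
    case (Cons a L)
    obtain A B where a: "a = (A, B)" by (cases a)
    have "inner (sandwich (a # L) z x) ((C \<cdot> z \<cdot> D) y)
        = inner ((A \<cdot> z \<cdot> B) x) ((C \<cdot> z \<cdot> D) y) + inner (sandwich L z x) ((C \<cdot> z \<cdot> D) y)"
      by (simp only: a sandwich_simps blinfun.add_left inner_add_left)
    also have "\<dots> = inner ((A \<cdot> (w \<cdot> z) \<cdot> B) x) ((C \<cdot> e \<cdot> D) y) + inner (sandwich L (w \<cdot> z) x) ((C \<cdot> e \<cdot> D) y)"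
      using Cons single[OF _ that, of A B D] by (auto simp: a simp del: blinfun_apply_blinfun_compose)
    finally show ?case
      by (simp only: a sandwich_simps blinfun.add_left inner_add_left)
  qed simp
  show ?thesis
    using M
  proof (induction M)
    case (Cons a M)
    obtain C D where a: "a = (C, D)" by (cases a)
    have "inner (sandwich L z x) (sandwich (a # M) z y)
        = inner (sandwich L z x) ((C \<cdot> z \<cdot> D) y) + inner (sandwich L z x) (sandwich M z y)"
      by (simp only: a sandwich_simps blinfun.add_left inner_add_right)
    also have "\<dots> = inner (sandwich L (w \<cdot> z) x) ((C \<cdot> e \<cdot> D) y) + inner (sandwich L (w \<cdot> z) x) (sandwich M e y)"
      using Cons row[of C D] by (auto simp: a simp del: blinfun_apply_blinfun_compose)
    finally show ?case
      by (simp only: a sandwich_simps blinfun.add_left inner_add_right)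
  qed simp
qed

text \<open>With \<open>g z = \<parallel>\<Sum>A\<^sub>i z B\<^sub>i x\<parallel>\<close>, Cauchy--Schwarz gives \<open>(g z)\<^sup>2 \<le> g (z\<^sup>* z) g e\<close>, so that the supremum \<open>c\<close>
  of \<open>g\<close> over the unit ball satisfies \<open>c\<^sup>2 \<le> c g e\<close>.\<close>

lemma sandwich_bound:
  assumes e: "projection_op e" "e \<in> U" and z: "z \<in> corner_center e" and L: "set L \<subseteq> U \<times> U"
  shows "norm (sandwich L z x) \<le> norm z * norm (sandwich L e x)"
proof -
  define B where "B = {z \<in> corner_center e. norm z \<le> 1}"
  define g where "g z = norm (sandwich L z x)" for z
  define K where "K = (\<Sum>(A, B)\<leftarrow>L. norm A * norm B) * norm x"
  define c where "c = (SUP z\<in>B. g z)"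
  have K0: "0 \<le> (\<Sum>(A, B)\<leftarrow>L. norm A * norm B)" by (intro sum_list_nonneg) auto
  have "g z \<le> K" if "z \<in> B" for z
  proof -
    have "g z \<le> norm (sandwich L z) * norm x" unfolding g_def by (rule norm_blinfun)
    also have "\<dots> \<le> (\<Sum>(A, B)\<leftarrow>L. norm A * norm B) * norm z * norm x"
      by (intro mult_right_mono sandwich_norm_le) auto
    also have "\<dots> \<le> (\<Sum>(A, B)\<leftarrow>L. norm A * norm B) * 1 * norm x"
      using that K0 by (intro mult_right_mono mult_left_mono) (auto simp: B_def)
    finally show ?thesis by (simp add: K_def)
  qed
  then have bdd: "bdd_above (g ` B)" by (intro bdd_aboveI[of _ K]) auto
  have B0: "0 \<in> B" by (simp add: B_def corner_center_def)
  have gc: "g z \<le> c" if "z \<in> B" for z unfolding c_def by (intro cSUP_upper that bdd)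
  have c0: "0 \<le> c" using gc[OF B0] by (rule order_trans[rotated]) (simp add: g_def)
  have sq: "(g z)\<^sup>2 \<le> c * g e" if "z \<in> B" for z
  proof -
    have z: "z \<in> corner_center e" "norm z \<le> 1" using that by (auto simp: B_def)
    obtain w where w: "w \<in> U" "is_adjoint z w" using adjoint_in corner_centerD(1)[OF z(1)] by blast
    have "norm (w \<cdot> z) \<le> norm w * norm z" by (rule norm_blinfun_compose)
    also have "\<dots> \<le> 1" using z adjoint_norm_le[OF w(2)] by (intro mult_le_one) auto
    finally have "w \<cdot> z \<in> B"
      using corner_center_compose[OF corner_center_adjoint[OF e(1) z(1) w] z(1)] by (simp add: B_def)
    have "(g z)\<^sup>2 = inner (sandwich L (w \<cdot> z) x) (sandwich L e x)"
      unfolding g_def power2_norm_eq_inner by (rule sandwich_inner[OF e z(1) w L L])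
    also have "\<dots> \<le> g (w \<cdot> z) * g e" unfolding g_def by (rule norm_cauchy_schwarz)
    also have "\<dots> \<le> c * g e"
      using gc[OF \<open>w \<cdot> z \<in> B\<close>] by (intro mult_right_mono) (auto simp: g_def)
    finally show ?thesis .
  qed
  have ge0: "0 \<le> g e" by (simp add: g_def)
  have "g z \<le> sqrt (c * g e)" if "z \<in> B" for z
    using sq[OF that] by (rule real_le_rsqrt)
  then have "c \<le> sqrt (c * g e)"
    using B0 by (subst c_def) (auto intro!: cSUP_least)
  then have "c\<^sup>2 \<le> c * g e" using c0 ge0 by (metis real_sqrt_le_iff real_sqrt_pow2 real_sqrt_power real_sqrt_unique)
  then have ce: "c \<le> g e"
    using c0 ge0 by (cases "c = 0") (auto simp: power2_eq_square mult_le_cancel_left)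
  show ?thesis
  proof (cases "z = 0")
    case True
    have "sandwich L 0 = 0" using L by (induction L) auto
    then show ?thesis using True by simp
  next
    case False
    let ?z = "(1 / norm z) *\<^sub>R z"
    have "?z \<in> B" using corner_center_scaleR[OF z] False by (simp add: B_def)
    then have "g ?z \<le> g e" using gc ce order_trans by blast
    moreover have "sandwich L (c *\<^sub>R z) = c *\<^sub>R sandwich L z" for c
      by (induction L) (auto simp: scaleR_add_right
          bounded_bilinear.scaleR_left[OF bounded_bilinear_blinfun_compose]
          bounded_bilinear.scaleR_right[OF bounded_bilinear_blinfun_compose])
    ultimately have "g z / norm z \<le> g e" by (simp add: g_def blinfun.scaleR_left)
    then show ?thesis using False by (simp add: g_def field_simps)
  qed
qed

end

section \<open>The ideal generated by a projection\<close>

locale corner = von_neumann U for U :: "'h::complex_hilbert operator set" +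
  fixes e :: "'h operator"
  assumes e: "e \<in> U" "projection_op e"
begin

lemma e_idem: "e \<cdot> e = e"
  using e by (simp add: projection_op_def)

text \<open>The two-sided ideal generated by \<open>e\<close> in the algebraic sense, without any
  closure.\<close>

definition "corner_ideal = {sandwich L e |L. set L \<subseteq> U \<times> U}"

lemma sandwich_in: "set L \<subseteq> U \<times> U \<Longrightarrow> z \<in> U \<Longrightarrow> sandwich L z \<in> U"
  by (induction L) auto

sublocale two_sided_ideal U corner_ideal
proof
  show "corner_ideal \<subseteq> U" by (auto simp: corner_ideal_def sandwich_in e)
  have "sandwich [] e \<in> corner_ideal" unfolding corner_ideal_def by (intro CollectI exI[of _ "[]"]) auto
  then show "0 \<in> corner_ideal" by simp
  show "A + B \<in> corner_ideal" if "A \<in> corner_ideal" "B \<in> corner_ideal" for A B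
  proof -
    from that obtain L M where LM: "A = sandwich L e" "set L \<subseteq> U \<times> U" "B = sandwich M e" "set M \<subseteq> U \<times> U"
      by (auto simp: corner_ideal_def)
    then have "A + B = sandwich (L @ M) e" "set (L @ M) \<subseteq> U \<times> U" by auto
    then show ?thesis unfolding corner_ideal_def by blast
  qed
  show "A \<cdot> B \<in> corner_ideal" if "A \<in> U" "B \<in> corner_ideal" for A B
  proof -
    from that(2) obtain L where L: "B = sandwich L e" "set L \<subseteq> U \<times> U"
      by (auto simp: corner_ideal_def)
    then have "A \<cdot> B = sandwich (map (\<lambda>(C, D). (A \<cdot> C, D)) L) e" by (simp add: sandwich_left)
    moreover have "set (map (\<lambda>(C, D). (A \<cdot> C, D)) L) \<subseteq> U \<times> U" using L that(1) by auto
    ultimately show ?thesis unfolding corner_ideal_def by blast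
  qed
  show "B \<cdot> A \<in> corner_ideal" if "B \<in> corner_ideal" "A \<in> U" for A B
  proof -
    from that(1) obtain L where L: "B = sandwich L e" "set L \<subseteq> U \<times> U"
      by (auto simp: corner_ideal_def)
    then have "B \<cdot> A = sandwich (map (\<lambda>(C, D). (C, D \<cdot> A)) L) e" by (simp add: sandwich_right)
    moreover have "set (map (\<lambda>(C, D). (C, D \<cdot> A)) L) \<subseteq> U \<times> U" using L that(2) by auto
    ultimately show ?thesis unfolding corner_ideal_def by blast
  qed
qed

lemma e_in_ideal: "e \<in> corner_ideal"
proof -
  have "sandwich [(e, e)] e = e" by (simp add: e_idem)
  moreover have "set [(e, e)] \<subseteq> U \<times> U" using e by simp
  ultimately show ?thesis unfolding corner_ideal_def by (metis (mono_tags, lifting) mem_Collect_eq)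
qed

text \<open>If \<open>e U\<close> kills \<open>D\<close>, so does the whole ideal, in particular
  every \<open>id_blinfun - resolvent S\<close>; in the limit \<open>R D = D\<close>. The same
  argument on the other side gives \<open>D = D R\<close>. Both \<open>P\<close> and
  \<open>I - P\<close> take the place of \<open>e\<close> later.\<close>

lemma annihilator:
  "\<exists>R. central_projection U R \<and> e \<cdot> R = 0 \<and>
    (\<forall>D\<in>U. (\<forall>A\<in>U. e \<cdot> A \<cdot> D = 0) \<longrightarrow> D = R \<cdot> D) \<and>
    (\<forall>D\<in>U. (\<forall>A\<in>U. D \<cdot> A \<cdot> e = 0) \<longrightarrow> D = D \<cdot> R)"
proof -
  obtain R where R: "central_projection U R" "\<And>j. j \<in> corner_ideal \<Longrightarrow> j \<cdot> R = 0"
    and lim: "\<And>x. ((\<lambda>S. resolvent S x) \<longlongrightarrow> R x) net"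
    using annihilator_projection by blast
  have "D = R \<cdot> D" if D: "\<forall>A\<in>U. e \<cdot> A \<cdot> D = 0" for D
  proof (rule blinfun_eqI)
    fix x
    have "j \<cdot> D = 0" if "j \<in> corner_ideal" for j
    proof -
      from that obtain L where L: "j = sandwich L e" "set L \<subseteq> U \<times> U" by (auto simp: corner_ideal_def)
      have "sandwich L e \<cdot> D = 0" using L(2)
        by (induction L) (use D in \<open>auto simp: compose_bilinear compose_assoc\<close>)
      then show ?thesis using L by simp
    qed
    then have "((id_blinfun - resolvent S) \<cdot> D) x = 0" if "S \<in> J_pos" for S
      using complement_in_J[OF that] by simp
    then have "\<forall>\<^sub>F S in net. resolvent S (D x) = D x"
      using eventually_J_pos by (auto elim!: eventually_mono simp: blinfun.diff_left)
    from Lim_transform_eventually[OF lim this]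
    show "D x = (R \<cdot> D) x" using tendsto_unique[OF net_not_bot tendsto_const] by fastforce
  qed
  moreover have "D = D \<cdot> R" if D: "\<forall>A\<in>U. D \<cdot> A \<cdot> e = 0" for D
  proof (rule blinfun_eqI)
    fix x
    have "D \<cdot> j = 0" if "j \<in> corner_ideal" for j
    proof -
      from that obtain L where L: "j = sandwich L e" "set L \<subseteq> U \<times> U" by (auto simp: corner_ideal_def)
      have "D \<cdot> sandwich L e = 0" using L(2)
        by (induction L) (use D in \<open>auto simp: compose_bilinear compose_assoc[symmetric]\<close>)
      then show ?thesis using L by simp
    qed
    then have "(D \<cdot> (id_blinfun - resolvent S)) x = 0" if "S \<in> J_pos" for S
      using complement_in_J[OF that] by simp
    then have "\<forall>\<^sub>F S in net. D (resolvent S x) = D x"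
      using eventually_J_pos by (auto elim!: eventually_mono simp: blinfun.diff_left blinfun.diff_right)
    from Lim_transform_eventually[OF blinfun.tendsto[OF tendsto_const lim] this]
    show "D x = (D \<cdot> R) x" using tendsto_unique[OF net_not_bot tendsto_const] by fastforce
  qed
  ultimately show ?thesis using R e_in_ideal by blast
qed

text \<open>The assignment of \<open>sandwich L z\<close> to \<open>sandwich L e\<close> is bounded
  by \<open>norm z\<close> on each vector and respects multiplication by \<open>U\<close>. Applied
  to \<open>id_blinfun - resolvent S\<close>, which tends strongly to \<open>id_blinfun - R\<close>,
  it yields operators \<open>t S\<close>, whose strong limit is the central element sought.\<close>

lemma central_extension:
  assumes z: "z \<in> corner_center e"
  shows "\<exists>\<zeta>\<in>center U. \<zeta> \<cdot> e = z"
proof -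
  obtain R where R: "central_projection U R" "\<And>j. j \<in> corner_ideal \<Longrightarrow> j \<cdot> R = 0"
    and lim: "\<And>x. ((\<lambda>S. resolvent S x) \<longlongrightarrow> R x) net"
    using annihilator_projection by blast
  have RU: "R \<in> U" and comm: "A \<in> U \<Longrightarrow> R \<cdot> A = A \<cdot> R" for A
    using R(1) by (auto simp: central_projection_def center_def)
  \<comment> \<open>The assignment is handled as a relation; that it is single-valued is contained
    in \<open>bound\<close>, applied to a difference.\<close>
  define G where "G = {(sandwich L e, sandwich L z) |L. set L \<subseteq> U \<times> U}"
  have bound: "norm (t x) \<le> norm z * norm (j x)" if "(j, t) \<in> G" for j t x
    using that sandwich_bound[OF e(2,1) z] by (auto simp: G_def)
  have G_I: "(sandwich L e, sandwich L z) \<in> G" if "set L \<subseteq> U \<times> U" for L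
    using that by (auto simp: G_def)
  have G_left: "(A \<cdot> j, A \<cdot> t) \<in> G" if "(j, t) \<in> G" "A \<in> U" for A j t
  proof -
    from that(1) obtain L where L: "j = sandwich L e" "t = sandwich L z" "set L \<subseteq> U \<times> U"
      by (auto simp: G_def)
    have "set (map (\<lambda>(C, D). (A \<cdot> C, D)) L) \<subseteq> U \<times> U" using L that(2) by auto
    from G_I[OF this] show ?thesis by (simp only: L sandwich_left)
  qed
  have G_right: "(j \<cdot> A, t \<cdot> A) \<in> G" if "(j, t) \<in> G" "A \<in> U" for A j t
  proof -
    from that(1) obtain L where L: "j = sandwich L e" "t = sandwich L z" "set L \<subseteq> U \<times> U"
      by (auto simp: G_def)
    have "set (map (\<lambda>(C, D). (C, D \<cdot> A)) L) \<subseteq> U \<times> U" using L that(2) by auto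
    from G_I[OF this] show ?thesis by (simp only: L sandwich_right)
  qed
  have G_add: "(j + k, t + u) \<in> G" if "(j, t) \<in> G" "(k, u) \<in> G" for j k t u
  proof -
    from that obtain L M where L: "j = sandwich L e" "t = sandwich L z" "set L \<subseteq> U \<times> U"
      "k = sandwich M e" "u = sandwich M z" "set M \<subseteq> U \<times> U"
      by (auto simp: G_def)
    then show ?thesis using G_I[of "L @ M"] by simp
  qed
  have G_diff: "(j - k, t - u) \<in> G" if "(j, t) \<in> G" "(k, u) \<in> G" for j k t u
    using G_add[OF that(1) G_left[OF that(2), of "- id_blinfun"]]
    by (simp add: compose_bilinear)
  have ez: "(e, z) \<in> G"
  proof -
    have "sandwich [(e, e)] z = z"
      using corner_centerD(2,3)[OF z] by simp
    then show ?thesis using G_I[of "[(e, e)]"] e by (simp add: e_idem)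
  qed
  have "\<forall>S\<in>J_pos. \<exists>t. (id_blinfun - resolvent S, t) \<in> G"
    using complement_in_J by (fastforce simp: corner_ideal_def G_def)
  then obtain t where t: "\<And>S. S \<in> J_pos \<Longrightarrow> (id_blinfun - resolvent S, t S) \<in> G"
    by metis
  have tU: "t S \<in> U" if "S \<in> J_pos" for S
    using t[OF that] sandwich_in corner_centerD(1)[OF z] by (auto simp: G_def)
  have "\<exists>l. ((\<lambda>S. t S x) \<longlongrightarrow> l) net" for x
  proof (rule convergent_if_eventually_close[OF net_not_bot])
    fix \<epsilon> :: real assume "\<epsilon> > 0"
    \<comment> \<open>Two resolvent vectors within \<open>d\<close> of the limit differ by at most
      \<open>2 * d\<close>; the denominator uses \<open>norm z + 1\<close> to cover
      \<open>z = 0\<close>.\<close>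
    define d where "d = \<epsilon> / (2 * (norm z + 1))"
    have d: "d > 0" using \<open>\<epsilon> > 0\<close> by (simp add: d_def add_nonneg_pos)
    have near: "\<forall>\<^sub>F S in net. S \<in> J_pos \<and> dist (resolvent S x) (R x) < d"
      by (intro eventually_conj eventually_J_pos tendstoD[OF lim d])
    then obtain S where S: "S \<in> J_pos" "dist (resolvent S x) (R x) < d"
      using eventually_happens'[OF net_not_bot] by blast
    have "\<forall>\<^sub>F T in net. dist (t T x) (t S x) < \<epsilon>"
      using near
    proof eventually_elim
      case (elim T)
      have "norm ((t T - t S) x) \<le> norm z * norm ((id_blinfun - resolvent T - (id_blinfun - resolvent S)) x)"
        using elim S by (intro bound G_diff t) auto
      also have "(id_blinfun - resolvent T - (id_blinfun - resolvent S)) x = resolvent S x - resolvent T x"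
        by (simp add: blinfun.diff_left)
      also have "norm \<dots> \<le> 2 * d"
        using dist_triangle2[of "resolvent S x" "resolvent T x" "R x"] S elim by (simp add: dist_norm)
      finally have "dist (t T x) (t S x) \<le> norm z * (2 * d)"
        by (simp add: dist_norm blinfun.diff_left mult_left_mono)
      also have "\<dots> < (norm z + 1) * (2 * d)" using d by simp
      also have "\<dots> = \<epsilon>"
      proof -
        have "2 * norm z + 2 \<noteq> 0" using norm_ge_zero[of z] by linarith
        then show ?thesis by (simp add: d_def divide_simps)
      qed
      finally show ?case .
    qed
    then show "\<exists>y. \<forall>\<^sub>F T in net. dist (t T x) y < \<epsilon>" by blast
  qed
  moreover have "\<forall>\<^sub>F S in net. norm (t S) \<le> norm z * 2"
    using eventually_J_pos
  proof eventually_elim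
    case (elim S)
    show ?case
    proof (rule norm_blinfun_bound)
      fix x
      have "norm (t S x) \<le> norm z * norm (x - resolvent S x)"
        using bound[OF t[OF elim], of x] by (simp add: blinfun.diff_left)
      also have "norm (x - resolvent S x) \<le> 2 * norm x"
        using norm_triangle_ineq4[of x "resolvent S x"] resolvent_contraction[OF J_posD[OF elim], of x] by linarith
      finally show "norm (t S x) \<le> norm z * 2 * norm x" by (simp add: mult_left_mono mult.assoc)
    qed simp
  qed
  ultimately obtain \<zeta> :: "'h operator" where \<zeta>: "\<And>x. ((\<lambda>S. t S x) \<longlongrightarrow> \<zeta> x) net"
    using strong_limit_exists[OF net_not_bot] by blast
  have \<zeta>U: "\<zeta> \<in> U"
    by (rule strong_limit_in[OF net_not_bot _ \<zeta>]) (use eventually_J_pos tU in \<open>auto elim: eventually_mono\<close>)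
  have "\<zeta> \<cdot> e = z"
  proof (rule blinfun_eqI)
    fix x
    \<comment> \<open>The partner of \<open>t S \<cdot> e - z\<close> is
      \<open>(id_blinfun - resolvent S) \<cdot> e - e\<close>, which equals
      \<open>- (resolvent S \<cdot> e)\<close> and tends strongly to
      \<open>- (R \<cdot> e) = 0\<close>.\<close>
    have "((\<lambda>S. t S (e x) - z x) \<longlongrightarrow> 0) net"
    proof (rule Lim_null_comparison)
      show "\<forall>\<^sub>F S in net. norm (t S (e x) - z x) \<le> norm z * norm (resolvent S (e x))"
        using eventually_J_pos
      proof eventually_elim
        case (elim S)
        have "norm ((t S \<cdot> e - z) x) \<le> norm z * norm (((id_blinfun - resolvent S) \<cdot> e - e) x)"
          by (intro bound G_diff G_right t elim e ez)
        then show ?case by (simp add: blinfun.diff_left)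
      qed
      have "R (e x) = 0"
        using comm[OF e(1)] R(2)[OF e_in_ideal] by (metis blinfun_apply_blinfun_compose blinfun.zero_left)
      then show "((\<lambda>S. norm z * norm (resolvent S (e x))) \<longlongrightarrow> 0) net"
        using tendsto_mult_right_zero[OF tendsto_norm_zero] lim[of "e x"] by simp
    qed
    moreover have "((\<lambda>S. t S (e x) - z x) \<longlongrightarrow> \<zeta> (e x) - z x) net"
      by (rule tendsto_diff[OF \<zeta> tendsto_const])
    ultimately have "0 = \<zeta> (e x) - z x" by (rule tendsto_unique[OF net_not_bot])
    then show "(\<zeta> \<cdot> e) x = z x" by simp
  qed
  moreover have "\<zeta> \<cdot> A = A \<cdot> \<zeta>" if A: "A \<in> U" for A
  proof (rule blinfun_eqI)
    fix x
    \<comment> \<open>Likewise the partner of the commutator of \<open>A\<close> and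
      \<open>t S\<close> is the commutator of \<open>A\<close> and
      \<open>id_blinfun - resolvent S\<close>, whose limit vanishes because \<open>R\<close> is
      central.\<close>
    have "((\<lambda>S. A (t S x) - t S (A x)) \<longlongrightarrow> 0) net"
    proof (rule Lim_null_comparison)
      show "\<forall>\<^sub>F S in net. norm (A (t S x) - t S (A x)) \<le> norm z * norm (resolvent S (A x) - A (resolvent S x))"
        using eventually_J_pos
      proof eventually_elim
        case (elim S)
        have "norm ((A \<cdot> t S - t S \<cdot> A) x)
            \<le> norm z * norm ((A \<cdot> (id_blinfun - resolvent S) - (id_blinfun - resolvent S) \<cdot> A) x)"
          by (intro bound G_diff G_left G_right t elim A)
        then show ?case by (simp add: blinfun.diff_left blinfun.diff_right)
      qed
      have "((\<lambda>S. resolvent S (A x) - A (resolvent S x)) \<longlongrightarrow> R (A x) - A (R x)) net"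
        by (rule tendsto_diff[OF lim blinfun.tendsto[OF tendsto_const lim]])
      moreover have "R (A x) - A (R x) = 0"
        using arg_cong[OF comm[OF A], of "\<lambda>B. blinfun_apply B x"] by simp
      ultimately show "((\<lambda>S. norm z * norm (resolvent S (A x) - A (resolvent S x))) \<longlongrightarrow> 0) net"
        using tendsto_mult_right_zero[OF tendsto_norm_zero] by simp
    qed
    moreover have "((\<lambda>S. A (t S x) - t S (A x)) \<longlongrightarrow> A (\<zeta> x) - \<zeta> (A x)) net"
      by (rule tendsto_diff[OF blinfun.tendsto[OF tendsto_const \<zeta>] \<zeta>])
    ultimately have "0 = A (\<zeta> x) - \<zeta> (A x)" by (rule tendsto_unique[OF net_not_bot])
    then show "(\<zeta> \<cdot> A) x = (A \<cdot> \<zeta>) x" by simp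
  qed
  ultimately show ?thesis using \<zeta>U by (auto simp: center_def)
qed

end

section \<open>Peirce decomposition\<close>

lemma center_iff: "Z \<in> center U \<longleftrightarrow> Z \<in> U \<and> (\<forall>A\<in>U. Z \<cdot> A = A \<cdot> Z)"
  by (simp add: center_def)

context von_neumann
begin

lemma center_diff: "A \<in> center U \<Longrightarrow> B \<in> center U \<Longrightarrow> A - B \<in> center U"
  by (auto simp: center_iff compose_bilinear)

lemma center_add: "A \<in> center U \<Longrightarrow> B \<in> center U \<Longrightarrow> A + B \<in> center U"
  by (auto simp: center_iff compose_bilinear)

end

text \<open>The two annihilation hypotheses are the form in which the data on \<open>P\<close> are
  used: the first comes from the central carrier \<open>E2\<close> and commutativity on
  \<open>E1\<close>, the second from core-freeness. The first speaks of commutators because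
  \<open>P U\<close> also annihilates the abelian summand, where commutators vanish.\<close>

locale peirce = von_neumann U for U :: "'h::complex_hilbert operator set" +
  fixes P :: "'h operator"
  assumes P_in [simp]: "P \<in> U" and P_idem [simp]: "P \<cdot> P = P"
    and commute_if_annihilated:
      "\<And>A B. A \<in> U \<Longrightarrow> B \<in> U \<Longrightarrow> (\<And>C. C \<in> U \<Longrightarrow> P \<cdot> C \<cdot> (A \<cdot> B - B \<cdot> A) = 0) \<Longrightarrow> A \<cdot> B = B \<cdot> A"
    and zero_if_annihilates:
      "\<And>D. D \<in> U \<Longrightarrow> (\<And>C. C \<in> U \<Longrightarrow> D \<cdot> C \<cdot> (id_blinfun - P) = 0) \<Longrightarrow> D = 0"
begin

definition "Q = id_blinfun - P"

lemma Q_in [simp]: "Q \<in> U" by (simp add: Q_def)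

lemma PQ_simps [simp]:
  "P \<cdot> Q = 0" "Q \<cdot> P = 0" "Q \<cdot> Q = Q"
  "P \<cdot> (P \<cdot> X) = P \<cdot> X" "P \<cdot> (Q \<cdot> X) = 0" "Q \<cdot> (P \<cdot> X) = 0" "Q \<cdot> (Q \<cdot> X) = Q \<cdot> X"
  by (simp_all add: Q_def compose_bilinear compose_assoc[symmetric])

lemma split_left: "X = P \<cdot> X + Q \<cdot> X" and split_right: "X = X \<cdot> P + X \<cdot> Q"
  by (simp_all add: Q_def compose_bilinear)

lemma commutes_Q:
  assumes "X \<cdot> P = P \<cdot> X" shows "X \<cdot> Q = Q \<cdot> X"
  using assms by (simp add: Q_def compose_bilinear)

lemma diagonal_iff: "X \<cdot> P = P \<cdot> X \<longleftrightarrow> P \<cdot> X \<cdot> Q = 0 \<and> Q \<cdot> X \<cdot> P = 0"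
proof
  assume "X \<cdot> P = P \<cdot> X"
  then show "P \<cdot> X \<cdot> Q = 0 \<and> Q \<cdot> X \<cdot> P = 0"
    by (simp add: commutes_Q compose_assoc)
next
  assume "P \<cdot> X \<cdot> Q = 0 \<and> Q \<cdot> X \<cdot> P = 0"
  moreover have "X \<cdot> P = P \<cdot> X \<cdot> P + Q \<cdot> X \<cdot> P"
    using split_left[of "X \<cdot> P"] by (simp add: compose_assoc)
  moreover have "P \<cdot> X = P \<cdot> X \<cdot> P + P \<cdot> X \<cdot> Q"
    by (rule split_right)
  ultimately show "X \<cdot> P = P \<cdot> X" by simp
qed

text \<open>Rewrite rules that move \<open>P\<close> and \<open>Q\<close> to the left past a
  diagonal element; the versions with \<open>Z\<close> serve right-nested products.\<close>

lemma diagonal_rules: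
  assumes "X \<cdot> P = P \<cdot> X"
  shows "X \<cdot> P = P \<cdot> X" "X \<cdot> (P \<cdot> Z) = P \<cdot> (X \<cdot> Z)" "X \<cdot> Q = Q \<cdot> X" "X \<cdot> (Q \<cdot> Z) = Q \<cdot> (X \<cdot> Z)"
  using assms commutes_Q[OF assms] by (simp_all add: compose_assoc[symmetric])

text \<open>Commutation with \<open>P U Q\<close> passes to the diagonal corners:
  \<open>P A P C Q\<close> and \<open>P C Q A Q\<close> are again in \<open>P U Q\<close>, so
  \<open>[Y, P A P] C Q\<close> and \<open>P C [Y, Q A Q]\<close> vanish, and the two hypotheses of
  \<open>peirce\<close> apply.\<close>

lemma center_criterion:
  assumes Y: "Y \<in> U" and diag: "Y \<cdot> P = P \<cdot> Y"
    and b: "\<And>C. C \<in> U \<Longrightarrow> Y \<cdot> (P \<cdot> C \<cdot> Q) = P \<cdot> C \<cdot> Q \<cdot> Y"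
    and v: "\<And>C. C \<in> U \<Longrightarrow> Y \<cdot> (Q \<cdot> C \<cdot> P) = Q \<cdot> C \<cdot> P \<cdot> Y"
  shows "Y \<in> center U"
  unfolding center_iff
proof (intro conjI ballI Y)
  fix A assume A: "A \<in> U"
  note rules = compose_assoc compose_bilinear diagonal_rules[OF diag]
  have b': "P \<cdot> (Y \<cdot> (C \<cdot> Q)) = P \<cdot> (C \<cdot> (Q \<cdot> Y))" if "C \<in> U" for C
    using b[OF that] by (simp add: rules)
  have b'': "P \<cdot> (C \<cdot> (Q \<cdot> (Y \<cdot> Z))) = P \<cdot> (Y \<cdot> (C \<cdot> (Q \<cdot> Z)))" if "C \<in> U" for C Z
    using arg_cong[OF b'[OF that], of "\<lambda>T. T \<cdot> Z"] by (simp add: rules)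
  have 1: "Y \<cdot> (P \<cdot> A \<cdot> P) = P \<cdot> A \<cdot> P \<cdot> Y"
  proof -
    have "Y \<cdot> (P \<cdot> A \<cdot> P) - P \<cdot> A \<cdot> P \<cdot> Y = 0"
    proof (rule zero_if_annihilates)
      show "(Y \<cdot> (P \<cdot> A \<cdot> P) - P \<cdot> A \<cdot> P \<cdot> Y) \<cdot> C \<cdot> (id_blinfun - P) = 0" if "C \<in> U" for C
        unfolding Q_def[symmetric]
        using b'[OF that] b'[of "A \<cdot> (P \<cdot> C)"] that A by (simp add: rules)
    qed (use A Y in simp)
    then show ?thesis by simp
  qed
  have 2: "Y \<cdot> (Q \<cdot> A \<cdot> Q) = Q \<cdot> A \<cdot> Q \<cdot> Y"
  proof (rule commute_if_annihilated)
    fix C assume C: "C \<in> U"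
    show "P \<cdot> C \<cdot> (Y \<cdot> (Q \<cdot> A \<cdot> Q) - Q \<cdot> A \<cdot> Q \<cdot> Y) = 0"
      using b''[OF C, of "A \<cdot> Q"] b'[of "C \<cdot> (Q \<cdot> A)"] C A by (simp add: rules)
  qed (use A Y in simp_all)
  have eq: "A = P \<cdot> A \<cdot> P + P \<cdot> A \<cdot> Q + (Q \<cdot> A \<cdot> P + Q \<cdot> A \<cdot> Q)"
    using split_left[of A] split_right[of "P \<cdot> A"] split_right[of "Q \<cdot> A"] by simp
  show "Y \<cdot> A = A \<cdot> Y"
    by (subst (1 2) eq) (simp only: compose_bilinear(1,2) 1 2 b[OF A] v[OF A])
qed

text \<open>Adding a large multiple of \<open>P\<close> makes every element of the corner \<open>P U P\<close> invertible there.\<close>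

lemma corner_diff_invertible:
  assumes d: "d \<in> U" "P \<cdot> d = d" "d \<cdot> P = d"
  obtains c c' a a' where "d = c - a" "c \<in> U" "c' \<in> U" "a \<in> U" "a' \<in> U"
    "P \<cdot> c = c" "c \<cdot> P = c" "P \<cdot> c' = c'" "c' \<cdot> P = c'" "c \<cdot> c' = P" "c' \<cdot> c = P"
    "P \<cdot> a = a" "a \<cdot> P = a" "P \<cdot> a' = a'" "a' \<cdot> P = a'" "a \<cdot> a' = P" "a' \<cdot> a = P"
proof -
  define l where "l = norm d + 1"
  have l: "l > 0" by (simp add: l_def add_nonneg_pos)
  define K where "K = (- (1 / l)) *\<^sub>R d"
  note sc = bounded_bilinear.scaleR_left[OF bounded_bilinear_blinfun_compose]
    bounded_bilinear.scaleR_right[OF bounded_bilinear_blinfun_compose]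
  have K: "K \<in> U" "P \<cdot> K = K" "K \<cdot> P = K" using d by (simp_all add: K_def sc compose_bilinear)
  have "norm K < 1" using l by (simp add: K_def l_def)
  then obtain N where N: "N \<in> U" "N \<cdot> (id_blinfun - K) = id_blinfun" "(id_blinfun - K) \<cdot> N = id_blinfun"
    using neumann_inverse[OF K(1)] by blast
  have NP: "N \<cdot> P = P \<cdot> N"
  proof -
    have "N \<cdot> P = N \<cdot> (P \<cdot> (id_blinfun - K)) \<cdot> N"
      using N(3) by (simp add: compose_assoc)
    also have "P \<cdot> (id_blinfun - K) = (id_blinfun - K) \<cdot> P"
      using K by (simp add: compose_bilinear)
    also have "N \<cdot> ((id_blinfun - K) \<cdot> P) \<cdot> N = P \<cdot> N"
      using N(2) by (simp add: compose_assoc[symmetric])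
    finally show ?thesis .
  qed
  have lK: "l *\<^sub>R K = - d" using l by (simp add: K_def)
  have c: "d + l *\<^sub>R P = l *\<^sub>R ((id_blinfun - K) \<cdot> P)"
    using K by (simp add: compose_bilinear scaleR_diff_right lK)
  have PK: "P \<cdot> (id_blinfun - K) = (id_blinfun - K) \<cdot> P" using K by (simp add: compose_bilinear)
  show thesis
  proof (rule that[of "d + l *\<^sub>R P" "l *\<^sub>R P" "(1 / l) *\<^sub>R (N \<cdot> P)" "(1 / l) *\<^sub>R P"])
    show "(d + l *\<^sub>R P) \<cdot> ((1 / l) *\<^sub>R (N \<cdot> P)) = P"
    proof -
      have "(id_blinfun - K) \<cdot> P \<cdot> (N \<cdot> P) = (id_blinfun - K) \<cdot> (P \<cdot> N) \<cdot> P" by (simp add: compose_assoc)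
      also have "\<dots> = (id_blinfun - K) \<cdot> N \<cdot> P \<cdot> P" by (simp only: NP[symmetric] compose_assoc)
      also have "\<dots> = P" by (simp add: N)
      finally show ?thesis unfolding c using l by (simp add: sc)
    qed
    show "(1 / l) *\<^sub>R (N \<cdot> P) \<cdot> (d + l *\<^sub>R P) = P"
    proof -
      have "(N \<cdot> P) \<cdot> ((id_blinfun - K) \<cdot> P) = N \<cdot> (P \<cdot> (id_blinfun - K)) \<cdot> P" by (simp add: compose_assoc)
      also have "\<dots> = N \<cdot> (id_blinfun - K) \<cdot> P \<cdot> P" by (simp only: PK compose_assoc)
      also have "\<dots> = P" by (simp add: N)
      finally show ?thesis unfolding c using l by (simp add: sc)
    qed
    show "P \<cdot> ((1 / l) *\<^sub>R (N \<cdot> P)) = (1 / l) *\<^sub>R (N \<cdot> P)"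
      by (simp add: sc NP)
  qed (use l d N in \<open>simp_all add: sc compose_bilinear compose_assoc\<close>)
qed

end

section \<open>Maps satisfying the identities on pairs with product P\<close>

definition signed :: "nat \<Rightarrow> 'a::ab_group_add \<Rightarrow> 'a"
  where "signed k X = (if even k then X else - X)"

lemma signed_eq_iff [simp]: "signed k X = signed k Y \<longleftrightarrow> X = Y"
  by (simp add: signed_def)

lemma signed_zero [simp]: "signed k 0 = 0"
  by (simp add: signed_def)

lemma signed_eq_0_iff [simp]: "signed k X = 0 \<longleftrightarrow> X = 0" "0 = signed k X \<longleftrightarrow> X = 0"
  by (auto simp: signed_def)

text \<open>Only the substitution \<open>A\<^sub>3 = \<dots> = A\<^sub>n = P\<close> is needed: on \<open>P U Q\<close> and \<open>Q U P\<close>, where \<open>Q = I - P\<close>, the map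
  \<open>X \<mapsto> [X, P]\<close> acts as \<open>-1\<close> and \<open>1\<close>.\<close>

locale local_lie_centralizer = peirce U P for U :: "'h::complex_hilbert operator set" and P +
  fixes \<phi> :: "'h operator \<Rightarrow> 'h operator" and k :: nat
  assumes phi_in [simp]: "\<And>A. A \<in> U \<Longrightarrow> \<phi> A \<in> U"
    and phi_add: "\<And>A B. A \<in> U \<Longrightarrow> B \<in> U \<Longrightarrow> \<phi> (A + B) = \<phi> A + \<phi> B"
    and phi_left: "\<And>A B. A \<in> U \<Longrightarrow> B \<in> U \<Longrightarrow> A \<cdot> B = P \<Longrightarrow>
      \<phi> (((\<lambda>X. commutator X P) ^^ k) (commutator A B)) = ((\<lambda>X. commutator X P) ^^ k) (commutator (\<phi> A) B)"
    and phi_right: "\<And>A B. A \<in> U \<Longrightarrow> B \<in> U \<Longrightarrow> A \<cdot> B = P \<Longrightarrow>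
      \<phi> (((\<lambda>X. commutator X P) ^^ k) (commutator A B)) = ((\<lambda>X. commutator X P) ^^ k) (commutator A (\<phi> B))"
begin

abbreviation "ad \<equiv> (\<lambda>X. commutator X P)"

lemma ad_12: "P \<cdot> ((ad ^^ j) X) \<cdot> Q = signed j (P \<cdot> X \<cdot> Q)"
  by (induction j) (auto simp: commutator_def signed_def compose_bilinear compose_assoc)

lemma ad_21: "Q \<cdot> ((ad ^^ j) X) \<cdot> P = Q \<cdot> X \<cdot> P"
  by (induction j) (auto simp: commutator_def compose_bilinear compose_assoc)

lemma ad_eq_12: "P \<cdot> X = X \<Longrightarrow> X \<cdot> P = 0 \<Longrightarrow> (ad ^^ j) X = signed j X"
  by (induction j) (auto simp: commutator_def signed_def compose_bilinear)

lemma ad_eq_21: "P \<cdot> X = 0 \<Longrightarrow> X \<cdot> P = X \<Longrightarrow> (ad ^^ j) X = X"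
  by (induction j) (auto simp: commutator_def)

lemma phi_0 [simp]: "\<phi> 0 = 0"
  using phi_add[of 0 0] by simp

lemma phi_minus: assumes "A \<in> U" shows "\<phi> (- A) = - \<phi> A"
proof -
  have "\<phi> A + \<phi> (- A) = 0" using phi_add[of A "- A"] assms by simp
  then show ?thesis by (simp add: eq_neg_iff_add_eq_0 add.commute)
qed

lemma phi_diff: "A \<in> U \<Longrightarrow> B \<in> U \<Longrightarrow> \<phi> (A - B) = \<phi> A - \<phi> B"
  using phi_add[of A "- B"] phi_minus[of B] by simp

lemma phi_signed: "A \<in> U \<Longrightarrow> \<phi> (signed j A) = signed j (\<phi> A)"
  by (simp add: signed_def phi_minus)

section \<open>Identities from a single test pair\<close>

context
  fixes A B c
  assumes AB: "A \<in> U" "B \<in> U" "A \<cdot> B = P" and BA: "P - B \<cdot> A = - c"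
    and c: "c \<in> U"
begin

lemma commutator_eq: "commutator A B = - c"
  using AB BA by (simp add: commutator_def)

context
  assumes c12: "P \<cdot> c = c" "c \<cdot> P = 0"
begin

text \<open>Elements of \<open>P U Q\<close> are eigenvectors of \<open>ad\<close> for the
  eigenvalue -1, so \<open>ad ^^ k\<close> of the commutator \<open>- c\<close> is known
  completely.\<close>

lemma full_12:
  "- signed k (\<phi> c) = (ad ^^ k) (commutator (\<phi> A) B)"
  "- signed k (\<phi> c) = (ad ^^ k) (commutator A (\<phi> B))"
proof -
  have "(ad ^^ k) (commutator A B) = signed k (- c)"
    unfolding commutator_eq using c12 by (intro ad_eq_12) (simp_all add: compose_bilinear)
  then have "\<phi> ((ad ^^ k) (commutator A B)) = - signed k (\<phi> c)"
    using c by (simp add: phi_signed phi_minus) (simp add: signed_def)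
  then show "- signed k (\<phi> c) = (ad ^^ k) (commutator (\<phi> A) B)"
    "- signed k (\<phi> c) = (ad ^^ k) (commutator A (\<phi> B))"
    using phi_left[OF AB] phi_right[OF AB] by simp_all
qed

text \<open>On the corner \<open>P U Q\<close> both sides of \<open>full_12\<close> carry the sign
  \<open>(-1)^k\<close>, which cancels.\<close>

lemma upper_12:
  "- (P \<cdot> \<phi> c \<cdot> Q) = P \<cdot> commutator (\<phi> A) B \<cdot> Q"
  "- (P \<cdot> \<phi> c \<cdot> Q) = P \<cdot> commutator A (\<phi> B) \<cdot> Q"
proof -
  have "signed k (- (P \<cdot> \<phi> c \<cdot> Q)) = P \<cdot> (- signed k (\<phi> c)) \<cdot> Q"
    by (simp add: compose_bilinear signed_def)
  then show "- (P \<cdot> \<phi> c \<cdot> Q) = P \<cdot> commutator (\<phi> A) B \<cdot> Q"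
    "- (P \<cdot> \<phi> c \<cdot> Q) = P \<cdot> commutator A (\<phi> B) \<cdot> Q"
    using ad_12[of k "commutator (\<phi> A) B"] ad_12[of k "commutator A (\<phi> B)"]
    unfolding full_12[symmetric] by (metis signed_eq_iff)+
qed

text \<open>On the corner \<open>Q U P\<close> the map \<open>ad\<close> acts as the identity and
  the signs no longer cancel; the case \<open>\<phi> c = 0\<close> is what pairs with commutator 0
  require.\<close>

lemma lower_12:
  assumes "\<phi> c = 0" shows "Q \<cdot> commutator A (\<phi> B) \<cdot> P = 0"
  using ad_21[of k "commutator A (\<phi> B)"] unfolding full_12(2)[symmetric] by (simp add: assms)

end

context
  assumes c21: "P \<cdot> c = 0" "c \<cdot> P = c"
begin

lemma full_21: "- \<phi> c = (ad ^^ k) (commutator (\<phi> A) B)"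
proof -
  have "(ad ^^ k) (commutator A B) = - c"
    unfolding commutator_eq using c21 by (intro ad_eq_21) (simp_all add: compose_bilinear)
  then show ?thesis
    using phi_left[OF AB] c by (simp add: phi_minus)
qed

lemma lower_21: "- (Q \<cdot> \<phi> c \<cdot> P) = Q \<cdot> commutator (\<phi> A) B \<cdot> P"
  using ad_21[of k "commutator (\<phi> A) B"] unfolding full_21[symmetric] by (simp add: compose_bilinear)

end

end

text \<open>Test pair \<open>(P, P)\<close>, with \<open>c = 0\<close>.\<close>

lemma phi_P_diagonal: "\<phi> P \<cdot> P = P \<cdot> \<phi> P"
  unfolding diagonal_iff
  using upper_12(2)[of P P 0] lower_12[of P P 0]
  by (simp add: commutator_def compose_bilinear compose_assoc)

lemmas phi_P_rules = diagonal_rules[OF phi_P_diagonal]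

text \<open>Test pair \<open>(P + b, P)\<close>, with \<open>c = b\<close>. The bracket of
  \<open>P + b\<close> and \<open>\<phi> P\<close> already lies in \<open>P U Q\<close>, so the
  identity determines all of \<open>\<phi> b\<close> and not just one corner.\<close>

lemma phi_12:
  assumes C: "C \<in> U"
  shows "\<phi> (P \<cdot> C \<cdot> Q) = \<phi> P \<cdot> (P \<cdot> C \<cdot> Q) - P \<cdot> C \<cdot> Q \<cdot> \<phi> P"
proof -
  let ?b = "P \<cdot> C \<cdot> Q"
  note rules = compose_assoc compose_bilinear phi_P_rules
  have com: "commutator (P + ?b) (\<phi> P) = ?b \<cdot> \<phi> P - \<phi> P \<cdot> ?b"
    by (simp add: commutator_def rules)
  have "- signed k (\<phi> ?b) = (ad ^^ k) (?b \<cdot> \<phi> P - \<phi> P \<cdot> ?b)"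
    unfolding com[symmetric] using C by (intro full_12) (simp_all add: compose_assoc compose_bilinear)
  also have "\<dots> = signed k (?b \<cdot> \<phi> P - \<phi> P \<cdot> ?b)"
    by (intro ad_eq_12) (simp_all add: rules)
  finally show ?thesis by (auto simp: signed_def split: if_splits) (metis minus_diff_eq minus_minus)
qed

text \<open>Test pair \<open>(P, P + v)\<close>, with \<open>c = v\<close> and \<open>\<phi>\<close>
  on the first entry; on \<open>Q U P\<close> no sign arises.\<close>

lemma phi_21:
  assumes C: "C \<in> U"
  shows "\<phi> (Q \<cdot> C \<cdot> P) = Q \<cdot> C \<cdot> P \<cdot> \<phi> P - \<phi> P \<cdot> (Q \<cdot> C \<cdot> P)"
proof -
  let ?v = "Q \<cdot> C \<cdot> P"
  note rules = compose_assoc compose_bilinear phi_P_rules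
  have com: "commutator (\<phi> P) (P + ?v) = \<phi> P \<cdot> ?v - ?v \<cdot> \<phi> P"
    by (simp add: commutator_def rules)
  have "- \<phi> ?v = (ad ^^ k) (\<phi> P \<cdot> ?v - ?v \<cdot> \<phi> P)"
    unfolding com[symmetric] using C by (intro full_21) (simp_all add: compose_assoc compose_bilinear)
  also have "\<dots> = \<phi> P \<cdot> ?v - ?v \<cdot> \<phi> P"
    by (intro ad_eq_21) (simp_all add: rules)
  finally show ?thesis by (metis minus_diff_eq minus_minus)
qed

lemma corner_rules:
  assumes "P \<cdot> c = c" "c \<cdot> P = c"
  shows "P \<cdot> c = c" "P \<cdot> (c \<cdot> Z) = c \<cdot> Z" "c \<cdot> P = c" "c \<cdot> (P \<cdot> Z) = c \<cdot> Z"
    "Q \<cdot> c = 0" "Q \<cdot> (c \<cdot> Z) = 0" "c \<cdot> Q = 0" "c \<cdot> (Q \<cdot> Z) = 0"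
proof -
  show "P \<cdot> c = c" "P \<cdot> (c \<cdot> Z) = c \<cdot> Z" "c \<cdot> P = c" "c \<cdot> (P \<cdot> Z) = c \<cdot> Z"
    using assms by (simp_all add: compose_assoc[symmetric])
  show "Q \<cdot> c = 0" "c \<cdot> Q = 0" using assms by (simp_all add: Q_def compose_bilinear)
  then show "Q \<cdot> (c \<cdot> Z) = 0" "c \<cdot> (Q \<cdot> Z) = 0" by (simp_all add: compose_assoc[symmetric])
qed

lemma diagonal_corner_rules:
  assumes "Y \<cdot> P = P \<cdot> Y" "P \<cdot> c = c"
  shows "P \<cdot> (Y \<cdot> c) = Y \<cdot> c" "P \<cdot> (Y \<cdot> (c \<cdot> Z)) = Y \<cdot> (c \<cdot> Z)"
    "Q \<cdot> (Y \<cdot> c) = 0" "Q \<cdot> (Y \<cdot> (c \<cdot> Z)) = 0"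
proof -
  have "P \<cdot> (Y \<cdot> c) = Y \<cdot> (P \<cdot> c)" by (simp only: compose_assoc[symmetric] assms(1))
  then show 1: "P \<cdot> (Y \<cdot> c) = Y \<cdot> c" by (simp only: assms(2))
  then show 2: "Q \<cdot> (Y \<cdot> c) = 0" by (simp add: Q_def compose_bilinear)
  show "P \<cdot> (Y \<cdot> (c \<cdot> Z)) = Y \<cdot> (c \<cdot> Z)" using arg_cong[OF 1, of "\<lambda>T. T \<cdot> Z"] by (simp only: compose_assoc)
  show "Q \<cdot> (Y \<cdot> (c \<cdot> Z)) = 0" using arg_cong[OF 2, of "\<lambda>T. T \<cdot> Z"] by (simp add: compose_assoc)
qed

text \<open>Test pair \<open>(P + b, P - b d + d)\<close>: the term \<open>- b d\<close> restores
  the product \<open>P\<close>, and the reversed product is \<open>P + b\<close>. Comparison with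
  \<open>phi_12\<close> leaves \<open>P C [\<phi> P, d] = 0\<close>.\<close>

lemma phi_P_commutes_Q:
  assumes A: "A \<in> U"
  shows "\<phi> P \<cdot> (Q \<cdot> A \<cdot> Q) = Q \<cdot> A \<cdot> Q \<cdot> \<phi> P"
proof (rule commute_if_annihilated)
  note rules = compose_assoc compose_bilinear phi_P_rules
  fix C assume C: "C \<in> U"
  let ?b = "P \<cdot> C \<cdot> Q" and ?d = "Q \<cdot> A \<cdot> Q"
  have "- (P \<cdot> \<phi> ?b \<cdot> Q) = P \<cdot> commutator (\<phi> (P + ?b)) (P - ?b \<cdot> ?d + ?d) \<cdot> Q"
    using A C by (intro upper_12) (simp_all add: rules)
  also have "\<phi> (P + ?b) = \<phi> P + (\<phi> P \<cdot> ?b - ?b \<cdot> \<phi> P)"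
    using C by (simp add: phi_add phi_12)
  finally show "P \<cdot> C \<cdot> (\<phi> P \<cdot> (Q \<cdot> A \<cdot> Q) - Q \<cdot> A \<cdot> Q \<cdot> \<phi> P) = 0"
    unfolding phi_12[OF C] by (simp add: commutator_def rules)
qed (use A in simp_all)

text \<open>Test pair \<open>(c' + b, c)\<close>, whose reversed product is \<open>P + c b\<close>.
  Comparison with \<open>phi_12\<close> at \<open>b\<close> and at \<open>c b\<close> leaves
  \<open>[\<phi> P, c] C Q = 0\<close>.\<close>

lemma phi_P_commutes_invertible:
  assumes c: "c \<in> U" "c' \<in> U" "P \<cdot> c = c" "c \<cdot> P = c" "P \<cdot> c' = c'" "c' \<cdot> P = c'" "c \<cdot> c' = P" "c' \<cdot> c = P"
  shows "\<phi> P \<cdot> c = c \<cdot> \<phi> P"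
proof -
  note rules = compose_assoc compose_bilinear phi_P_rules corner_rules[OF c(3,4)] corner_rules[OF c(5,6)] c(7,8)
    diagonal_corner_rules[OF phi_P_diagonal c(3)]
  have eq: "- (P \<cdot> \<phi> (P \<cdot> (c \<cdot> C) \<cdot> Q) \<cdot> Q) = P \<cdot> commutator (\<phi> (c' + P \<cdot> C \<cdot> Q)) c \<cdot> Q" if "C \<in> U" for C
    using c(1,2) that by (intro upper_12) (simp_all add: rules)
  \<comment> \<open>The choice \<open>b = 0\<close> isolates the unknown corner of
    \<open>\<phi> c'\<close>.\<close>
  have c'Q: "c \<cdot> (\<phi> c' \<cdot> Q) = 0"
    using eq[of 0] by (simp add: commutator_def rules)
  have "\<phi> P \<cdot> c - c \<cdot> \<phi> P = 0"
  proof (rule zero_if_annihilates)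
    fix C assume C: "C \<in> U"
    have "c \<cdot> C \<in> U" using C c by simp
    have "\<phi> (c' + P \<cdot> C \<cdot> Q) = \<phi> c' + (\<phi> P \<cdot> (P \<cdot> C \<cdot> Q) - P \<cdot> C \<cdot> Q \<cdot> \<phi> P)"
      using C c by (simp add: phi_add phi_12)
    then show "(\<phi> P \<cdot> c - c \<cdot> \<phi> P) \<cdot> C \<cdot> (id_blinfun - P) = 0"
      using eq[OF C] unfolding Q_def[symmetric] phi_12[OF \<open>c \<cdot> C \<in> U\<close>]
      by (simp add: commutator_def rules c'Q)
  qed (use c in simp)
  then show ?thesis by simp
qed

lemma phi_P_commutes_P:
  assumes A: "A \<in> U"
  shows "\<phi> P \<cdot> (P \<cdot> A \<cdot> P) = P \<cdot> A \<cdot> P \<cdot> \<phi> P"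
proof -
  have d: "P \<cdot> A \<cdot> P \<in> U" "P \<cdot> (P \<cdot> A \<cdot> P) = P \<cdot> A \<cdot> P" "P \<cdot> A \<cdot> P \<cdot> P = P \<cdot> A \<cdot> P"
    using A by (simp_all add: compose_assoc)
  from corner_diff_invertible[OF d] obtain c c' a a' where ca: "P \<cdot> A \<cdot> P = c - a" "c \<in> U" "c' \<in> U" "a \<in> U" "a' \<in> U"
    "P \<cdot> c = c" "c \<cdot> P = c" "P \<cdot> c' = c'" "c' \<cdot> P = c'" "c \<cdot> c' = P" "c' \<cdot> c = P"
    "P \<cdot> a = a" "a \<cdot> P = a" "P \<cdot> a' = a'" "a' \<cdot> P = a'" "a \<cdot> a' = P" "a' \<cdot> a = P" .
  have "\<phi> P \<cdot> c = c \<cdot> \<phi> P" "\<phi> P \<cdot> a = a \<cdot> \<phi> P"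
    by (rule phi_P_commutes_invertible[OF ca(2,3,6-11)])
      (rule phi_P_commutes_invertible[OF ca(4,5,12-17)])
  then show ?thesis unfolding ca(1) by (simp add: compose_bilinear)
qed

text \<open>Next to \<open>P\<close> the factor \<open>\<phi> P\<close> acts as \<open>Y\<close>,
  next to \<open>Q\<close> as \<open>Z\<close>. In \<open>phi_12\<close> and \<open>phi_21\<close>
  alike the term adjacent to \<open>P\<close> has the sign plus and the one adjacent to
  \<open>Q\<close> the sign minus, so the same \<open>Y - Z\<close> serves both corners.\<close>

lemma multiplier_exists:
  assumes ext_P: "\<And>z. z \<in> corner_center P \<Longrightarrow> \<exists>\<zeta>\<in>center U. \<zeta> \<cdot> P = z"
    and ext_Q: "\<And>z. z \<in> corner_center Q \<Longrightarrow> \<exists>\<zeta>\<in>center U. \<zeta> \<cdot> Q = z"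
  shows "\<exists>W\<in>center U. \<forall>C\<in>U. \<phi> (P \<cdot> C \<cdot> Q) = W \<cdot> (P \<cdot> C \<cdot> Q) \<and> \<phi> (Q \<cdot> C \<cdot> P) = W \<cdot> (Q \<cdot> C \<cdot> P)"
proof -
  note rules = compose_assoc phi_P_rules
  have "P \<cdot> \<phi> P \<in> corner_center P"
    unfolding corner_center_def using phi_P_commutes_P by (simp add: rules)
  then obtain Y where Y: "Y \<in> center U" "Y \<cdot> P = P \<cdot> \<phi> P" using ext_P by blast
  have "Q \<cdot> \<phi> P \<in> corner_center Q"
    unfolding corner_center_def using phi_P_commutes_Q by (simp add: rules)
  then obtain Z where Z: "Z \<in> center U" "Z \<cdot> Q = Q \<cdot> \<phi> P" using ext_Q by blast
  have Yc: "A \<cdot> Y = Y \<cdot> A" and Zc: "A \<cdot> Z = Z \<cdot> A" if "A \<in> U" for A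
    using Y(1) Z(1) that by (auto simp: center_iff)
  have "\<phi> (P \<cdot> C \<cdot> Q) = (Y - Z) \<cdot> (P \<cdot> C \<cdot> Q)" if C: "C \<in> U" for C
  proof -
    have "\<phi> P \<cdot> (P \<cdot> C \<cdot> Q) = Y \<cdot> P \<cdot> (C \<cdot> Q)" unfolding Y(2) by (simp add: rules)
    moreover have "P \<cdot> C \<cdot> Q \<cdot> \<phi> P = P \<cdot> C \<cdot> (Z \<cdot> Q)" unfolding Z(2) by (simp add: rules)
    moreover have "\<dots> = Z \<cdot> (P \<cdot> C) \<cdot> Q"
      using Zc[of "P \<cdot> C"] C by (simp only: compose_assoc[symmetric] compose_in P_in)
    ultimately show ?thesis unfolding phi_12[OF C] by (simp add: compose_bilinear compose_assoc)
  qed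
  moreover have "\<phi> (Q \<cdot> C \<cdot> P) = (Y - Z) \<cdot> (Q \<cdot> C \<cdot> P)" if C: "C \<in> U" for C
  proof -
    have "\<phi> P \<cdot> (Q \<cdot> C \<cdot> P) = Z \<cdot> Q \<cdot> (C \<cdot> P)" unfolding Z(2) by (simp add: rules)
    moreover have "Q \<cdot> C \<cdot> P \<cdot> \<phi> P = Q \<cdot> C \<cdot> (Y \<cdot> P)" unfolding Y(2) by (simp add: rules)
    moreover have "\<dots> = Y \<cdot> (Q \<cdot> C) \<cdot> P"
      using Yc[of "Q \<cdot> C"] C by (simp only: compose_assoc[symmetric] compose_in Q_in)
    ultimately show ?thesis unfolding phi_21[OF C] by (simp add: compose_bilinear compose_assoc)
  qed
  moreover have "Y - Z \<in> center U"
    using Y(1) Z(1) by (rule center_diff)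
  ultimately show ?thesis by blast
qed

section \<open>Maps vanishing on the off-diagonal corners\<close>

context
  assumes off_12: "\<And>C. C \<in> U \<Longrightarrow> \<phi> (P \<cdot> C \<cdot> Q) = 0"
    and off_21: "\<And>C. C \<in> U \<Longrightarrow> \<phi> (Q \<cdot> C \<cdot> P) = 0"
begin

text \<open>The pair \<open>(c' + b, c)\<close> is used with \<open>\<phi>\<close> on the second
  entry and \<open>(c, c' + v)\<close> with \<open>\<phi>\<close> on the first, so that
  \<open>\<phi> c\<close> appears both times. As \<open>\<phi>\<close> vanishes on
  \<open>c b\<close> and \<open>v c\<close>, the hypotheses of \<open>center_criterion\<close>
  result.\<close>

lemma phi_invertible_central:
  assumes c: "c \<in> U" "c' \<in> U" "P \<cdot> c = c" "c \<cdot> P = c" "P \<cdot> c' = c'" "c' \<cdot> P = c'" "c \<cdot> c' = P" "c' \<cdot> c = P"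
  shows "\<phi> c \<in> center U"
proof -
  note rules = compose_assoc compose_bilinear corner_rules[OF c(3,4)] corner_rules[OF c(5,6)] c(7,8)
  let ?Y = "\<phi> c"
  have eq12: "- (P \<cdot> \<phi> (P \<cdot> (c \<cdot> C) \<cdot> Q) \<cdot> Q) = P \<cdot> commutator (c' + P \<cdot> C \<cdot> Q) ?Y \<cdot> Q" if "C \<in> U" for C
    using c(1,2) that by (intro upper_12) (simp_all add: rules)
  \<comment> \<open>The pair \<open>(c', c)\<close> has commutator 0 and shows that both
    off-diagonal corners of \<open>\<phi> c\<close> vanish after multiplication by
    \<open>c'\<close>; multiplying by the inverse \<open>c\<close> recovers them.\<close>
  have c'Q: "c' \<cdot> (?Y \<cdot> Q) = 0"
    using eq12[of 0] by (simp add: commutator_def rules)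
  have "Q \<cdot> commutator c' ?Y \<cdot> P = 0"
    using c(1,2) by (intro lower_12[where c = 0]) (simp_all add: rules)
  then have Qc': "Q \<cdot> (?Y \<cdot> c') = 0"
    by (simp add: commutator_def rules)
  have "P \<cdot> ?Y \<cdot> Q = c \<cdot> (c' \<cdot> (?Y \<cdot> Q))"
    by (simp only: compose_assoc c(7)[symmetric])
  moreover have "Q \<cdot> ?Y \<cdot> P = Q \<cdot> (?Y \<cdot> c') \<cdot> c"
    by (simp only: compose_assoc c(8))
  ultimately have diag: "?Y \<cdot> P = P \<cdot> ?Y"
    unfolding diagonal_iff by (simp add: c'Q Qc')
  note rules = rules diagonal_rules[OF diag] diagonal_corner_rules[OF diag c(5)]
  show ?thesis
  proof (rule center_criterion[OF _ diag])
    fix C assume C: "C \<in> U"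
    have cC: "c \<cdot> C \<in> U" "C \<cdot> c \<in> U" using c C by simp_all
    show "?Y \<cdot> (P \<cdot> C \<cdot> Q) = P \<cdot> C \<cdot> Q \<cdot> ?Y"
      using eq12[OF C] off_12[OF cC(1)] c'Q by (simp add: commutator_def rules)
    have "- (Q \<cdot> \<phi> (Q \<cdot> (C \<cdot> c) \<cdot> P) \<cdot> P) = Q \<cdot> commutator ?Y (c' + Q \<cdot> C \<cdot> P) \<cdot> P"
      using c(1,2) C by (intro lower_21) (simp_all add: rules)
    then show "?Y \<cdot> (Q \<cdot> C \<cdot> P) = Q \<cdot> C \<cdot> P \<cdot> ?Y"
      using off_21[OF cC(2)] by (simp add: commutator_def rules)
  qed (use c in simp)
qed

lemma phi_11_central:
  assumes A: "A \<in> U" shows "\<phi> (P \<cdot> A \<cdot> P) \<in> center U"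
proof -
  have d: "P \<cdot> A \<cdot> P \<in> U" "P \<cdot> (P \<cdot> A \<cdot> P) = P \<cdot> A \<cdot> P" "P \<cdot> A \<cdot> P \<cdot> P = P \<cdot> A \<cdot> P"
    using A by (simp_all add: compose_assoc)
  from corner_diff_invertible[OF d] obtain c c' a a' where ca: "P \<cdot> A \<cdot> P = c - a" "c \<in> U" "c' \<in> U" "a \<in> U" "a' \<in> U"
    "P \<cdot> c = c" "c \<cdot> P = c" "P \<cdot> c' = c'" "c' \<cdot> P = c'" "c \<cdot> c' = P" "c' \<cdot> c = P"
    "P \<cdot> a = a" "a \<cdot> P = a" "P \<cdot> a' = a'" "a' \<cdot> P = a'" "a \<cdot> a' = P" "a' \<cdot> a = P" .
  have "\<phi> c \<in> center U" "\<phi> a \<in> center U"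
    by (rule phi_invertible_central[OF ca(2,3,6-11)])
      (rule phi_invertible_central[OF ca(4,5,12-17)])
  then show ?thesis unfolding ca(1) using ca(2,4) by (simp add: phi_diff center_diff)
qed

text \<open>Test pairs \<open>(P + b, P - b d + d)\<close> and \<open>(P - d v + d, P + v)\<close>.
  Since \<open>\<phi> P\<close> is central and \<open>\<phi>\<close> kills \<open>b d\<close> and
  \<open>d v\<close>, only \<open>\<phi> d\<close> survives in the commutators.\<close>

lemma phi_22_central:
  assumes A: "A \<in> U" shows "\<phi> (Q \<cdot> A \<cdot> Q) \<in> center U"
proof -
  let ?d = "Q \<cdot> A \<cdot> Q"
  define Y where "Y = \<phi> ?d"
  note rules = compose_assoc compose_bilinear
  have "\<phi> P \<in> center U" using phi_11_central[of P] by simp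
  then have PZ: "Z \<cdot> \<phi> P = \<phi> P \<cdot> Z" if "Z \<in> U" for Z
    using that by (simp add: center_iff)
  have split12: "commutator B (\<phi> (P - P \<cdot> C \<cdot> Q \<cdot> ?d + ?d)) = commutator B Y" if "B \<in> U" "C \<in> U" for B C
  proof -
    have "\<phi> (P - P \<cdot> C \<cdot> Q \<cdot> ?d + ?d) = \<phi> P - \<phi> (P \<cdot> (C \<cdot> Q \<cdot> A) \<cdot> Q) + Y"
      using A that by (simp add: Y_def phi_add phi_diff compose_assoc)
    also have "\<phi> (P \<cdot> (C \<cdot> Q \<cdot> A) \<cdot> Q) = 0" using A that by (intro off_12) simp
    finally show ?thesis using PZ[OF that(1)] by (simp add: commutator_def rules)
  qed
  have split21: "commutator (\<phi> (P - ?d \<cdot> (Q \<cdot> C \<cdot> P) + ?d)) B = commutator Y B" if "B \<in> U" "C \<in> U" for B C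
  proof -
    have "\<phi> (P - ?d \<cdot> (Q \<cdot> C \<cdot> P) + ?d) = \<phi> P - \<phi> (Q \<cdot> (A \<cdot> Q \<cdot> C) \<cdot> P) + Y"
      using A that by (simp add: Y_def phi_add phi_diff compose_assoc)
    also have "\<phi> (Q \<cdot> (A \<cdot> Q \<cdot> C) \<cdot> P) = 0" using A that by (intro off_21) simp
    finally show ?thesis using PZ[OF that(1)] by (simp add: commutator_def rules)
  qed
  have eq12: "0 = P \<cdot> commutator (P + P \<cdot> C \<cdot> Q) Y \<cdot> Q" if C: "C \<in> U" for C
  proof -
    have "- (P \<cdot> \<phi> (P \<cdot> C \<cdot> Q) \<cdot> Q) =
        P \<cdot> commutator (P + P \<cdot> C \<cdot> Q) (\<phi> (P - P \<cdot> C \<cdot> Q \<cdot> ?d + ?d)) \<cdot> Q"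
      using A C by (intro upper_12) (simp_all add: rules)
    then show ?thesis using split12[OF _ C] off_12[OF C] C by simp
  qed
  \<comment> \<open>With \<open>C = 0\<close> the pair is \<open>(P, P + d)\<close>, which settles
    the corner \<open>Q U P\<close>; \<open>eq12\<close> at 0 settles the other one.\<close>
  have "Q \<cdot> commutator P (\<phi> (P - P \<cdot> 0 \<cdot> Q \<cdot> ?d + ?d)) \<cdot> P = 0"
    using A by (intro lower_12[where c = 0]) (simp_all add: rules)
  then have "Q \<cdot> commutator P Y \<cdot> P = 0"
    using split12[of P 0] by simp
  then have "P \<cdot> Y \<cdot> Q = 0 \<and> Q \<cdot> Y \<cdot> P = 0"
    using eq12[of 0] by (simp add: commutator_def rules)
  then have diag: "Y \<cdot> P = P \<cdot> Y"
    unfolding diagonal_iff .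
  note rules = rules diagonal_rules[OF diag]
  have "Y \<in> center U"
  proof (rule center_criterion[OF _ diag])
    fix C assume C: "C \<in> U"
    show "Y \<cdot> (P \<cdot> C \<cdot> Q) = P \<cdot> C \<cdot> Q \<cdot> Y"
      using eq12[OF C] by (simp add: commutator_def rules)
    have "- (Q \<cdot> \<phi> (Q \<cdot> C \<cdot> P) \<cdot> P) =
        Q \<cdot> commutator (\<phi> (P - ?d \<cdot> (Q \<cdot> C \<cdot> P) + ?d)) (P + Q \<cdot> C \<cdot> P) \<cdot> P"
      using A C by (intro lower_21) (simp_all add: compose_assoc compose_bilinear)
    then have "Q \<cdot> commutator Y (P + Q \<cdot> C \<cdot> P) \<cdot> P = 0"
      using split21[OF _ C] off_21[OF C] C by simp
    then show "Y \<cdot> (Q \<cdot> C \<cdot> P) = Q \<cdot> C \<cdot> P \<cdot> Y"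
      by (simp add: commutator_def rules)
  qed (use A in \<open>simp add: Y_def\<close>)
  then show ?thesis unfolding Y_def .
qed

lemma phi_central:
  assumes A: "A \<in> U" shows "\<phi> A \<in> center U"
proof -
  have "A = P \<cdot> A \<cdot> P + P \<cdot> A \<cdot> Q + (Q \<cdot> A \<cdot> P + Q \<cdot> A \<cdot> Q)"
    using split_left[of A] split_right[of "P \<cdot> A"] split_right[of "Q \<cdot> A"] by simp
  then have "\<phi> A = \<phi> (P \<cdot> A \<cdot> P + P \<cdot> A \<cdot> Q + (Q \<cdot> A \<cdot> P + Q \<cdot> A \<cdot> Q))"
    by (rule arg_cong)
  also have "\<dots> = \<phi> (P \<cdot> A \<cdot> P) + \<phi> (Q \<cdot> A \<cdot> Q)"
    using A by (simp add: phi_add off_12 off_21)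
  finally show ?thesis using phi_11_central[OF A] phi_22_central[OF A] by (simp add: center_add)
qed

end

lemma ad_in: "X \<in> U \<Longrightarrow> (ad ^^ j) X \<in> U"
  by (induction j) (simp_all add: commutator_def)

lemma ad_diff: "(ad ^^ j) (X - Y) = (ad ^^ j) X - (ad ^^ j) Y"
  by (induction j) (simp_all add: commutator_def compose_bilinear)

lemma ad_central:
  assumes W: "W \<in> center U" shows "(ad ^^ j) (W \<cdot> X) = W \<cdot> (ad ^^ j) X"
proof (induction j)
  case (Suc j)
  have "P \<cdot> (W \<cdot> Z) = W \<cdot> (P \<cdot> Z)" for Z
    using W by (simp add: center_iff compose_assoc[symmetric])
  then show ?case
    by (simp only: funpow.simps o_apply Suc) (simp add: commutator_def compose_bilinear compose_assoc)
qed simp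

text \<open>The identities are linear in \<open>\<phi>\<close> and hold for multiplication by a
  central element, so subtracting the multiplier of \<open>multiplier_exists\<close> stays within
  the locale and makes \<open>phi_central\<close> applicable.\<close>

lemma central_decomposition:
  assumes ext_P: "\<And>z. z \<in> corner_center P \<Longrightarrow> \<exists>\<zeta>\<in>center U. \<zeta> \<cdot> P = z"
    and ext_Q: "\<And>z. z \<in> corner_center Q \<Longrightarrow> \<exists>\<zeta>\<in>center U. \<zeta> \<cdot> Q = z"
  shows "\<exists>W\<in>center U. \<forall>A\<in>U. \<phi> A - W \<cdot> A \<in> center U"
proof -
  obtain W where W: "W \<in> center U"
    and off: "\<And>C. C \<in> U \<Longrightarrow> \<phi> (P \<cdot> C \<cdot> Q) = W \<cdot> (P \<cdot> C \<cdot> Q)"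
      "\<And>C. C \<in> U \<Longrightarrow> \<phi> (Q \<cdot> C \<cdot> P) = W \<cdot> (Q \<cdot> C \<cdot> P)"
    using multiplier_exists[OF assms] by blast
  have WU: "W \<in> U" and comm: "\<And>A. A \<in> U \<Longrightarrow> A \<cdot> W = W \<cdot> A"
    using W by (simp_all add: center_iff)
  have comm_W: "commutator (W \<cdot> A) B = W \<cdot> commutator A B" "commutator A (W \<cdot> B) = W \<cdot> commutator A B"
    if "A \<in> U" "B \<in> U" for A B
  proof -
    have "A \<cdot> (W \<cdot> Z) = W \<cdot> (A \<cdot> Z)" "B \<cdot> (W \<cdot> Z) = W \<cdot> (B \<cdot> Z)" for Z
      using comm[OF that(1)] comm[OF that(2)] by (simp_all add: compose_assoc[symmetric])
    then show "commutator (W \<cdot> A) B = W \<cdot> commutator A B" "commutator A (W \<cdot> B) = W \<cdot> commutator A B"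
      by (simp_all add: commutator_def compose_bilinear compose_assoc)
  qed
  have comm_diff: "commutator (A - C) B = commutator A B - commutator C B"
    "commutator B (A - C) = commutator B A - commutator B C" for A B C
    by (simp_all add: commutator_def compose_bilinear)
  have ad_in': "(ad ^^ k) (commutator A B) \<in> U" if "A \<in> U" "B \<in> U" for A B
    using that by (intro ad_in) (simp add: commutator_def)
  interpret psi: local_lie_centralizer U P "\<lambda>A. \<phi> A - W \<cdot> A" k
  proof
    show "\<phi> A - W \<cdot> A \<in> U" if "A \<in> U" for A using that WU by simp
    show "\<phi> (A + B) - W \<cdot> (A + B) = \<phi> A - W \<cdot> A + (\<phi> B - W \<cdot> B)" if "A \<in> U" "B \<in> U" for A B
      using that by (simp add: phi_add compose_bilinear)
    fix A B assume AB: "A \<in> U" "B \<in> U" "A \<cdot> B = P"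
    show "\<phi> ((ad ^^ k) (commutator A B)) - W \<cdot> (ad ^^ k) (commutator A B)
        = (ad ^^ k) (commutator (\<phi> A - W \<cdot> A) B)"
      unfolding phi_left[OF AB] by (simp only: comm_diff ad_diff comm_W[OF AB(1,2)] ad_central[OF W])
    show "\<phi> ((ad ^^ k) (commutator A B)) - W \<cdot> (ad ^^ k) (commutator A B)
        = (ad ^^ k) (commutator A (\<phi> B - W \<cdot> B))"
      unfolding phi_right[OF AB] by (simp only: comm_diff ad_diff comm_W[OF AB(1,2)] ad_central[OF W])
  qed
  have "\<phi> A - W \<cdot> A \<in> center U" if "A \<in> U" for A
    using that by (intro psi.phi_central) (simp_all add: off)
  then show ?thesis using W by blast
qed

end

section \<open>Commutator polynomials and central projections\<close>

lemma pn_tail_const: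
  assumes "\<And>i. i \<ge> 3 \<Longrightarrow> A i = P"
  shows "pn (Suc (Suc k)) A = ((\<lambda>X. commutator X P) ^^ k) (commutator (A 1) (A 2))"
proof (induction k)
  case 0
  show ?case by (simp add: numeral_2_eq_2)
next
  case (Suc k)
  then show ?case using assms[of "Suc (Suc (Suc k))"] by simp
qed

context von_neumann
begin

lemma pn_in: "(\<And>i. 1 \<le> i \<Longrightarrow> i \<le> n \<Longrightarrow> A i \<in> U) \<Longrightarrow> pn n A \<in> U"
  by (induction n A rule: pn.induct) (auto simp: commutator_def)

text \<open>The two argument lists agree from the third entry on, and a central factor passes
  through each further bracket.\<close>

lemma pn_central_multiple:
  assumes W: "W \<in> center U" and A: "\<And>i. 1 \<le> i \<Longrightarrow> i \<le> Suc (Suc k) \<Longrightarrow> A i \<in> U"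
    and B: "\<And>i. i \<ge> 3 \<Longrightarrow> B i = A i"
    and eq: "commutator (B 1) (B 2) = W \<cdot> commutator (A 1) (A 2)"
  shows "pn (Suc (Suc k)) B = W \<cdot> pn (Suc (Suc k)) A"
  using A
proof (induction k)
  case 0
  then show ?case using eq by (simp add: numeral_2_eq_2)
next
  case (Suc k)
  let ?i = "Suc (Suc (Suc k))"
  have "A ?i \<in> U" by (rule Suc.prems) auto
  then have "A ?i \<cdot> (W \<cdot> Z) = W \<cdot> (A ?i \<cdot> Z)" for Z
    using W by (simp add: center_iff compose_assoc[symmetric])
  moreover have "pn (Suc (Suc k)) B = W \<cdot> pn (Suc (Suc k)) A"
    by (rule Suc.IH) (rule Suc.prems, auto)
  ultimately show ?case
    using B[of ?i] unfolding pn.simps(3)[of "Suc k"]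
    by (simp add: commutator_def compose_bilinear compose_assoc del: pn.simps)
qed

lemma commutator_central_multiple:
  assumes W: "W \<in> center U" and Z: "Z \<in> center U" and A: "A \<in> U" and B: "B \<in> U"
  shows "commutator (W \<cdot> A + Z) B = W \<cdot> commutator A B"
    and "commutator A (W \<cdot> B + Z) = W \<cdot> commutator A B"
proof -
  have "B \<cdot> W = W \<cdot> B" "A \<cdot> W = W \<cdot> A"
    using W A B by (simp_all add: center_iff)
  then have "B \<cdot> (W \<cdot> A) = W \<cdot> (B \<cdot> A)" "A \<cdot> (W \<cdot> B) = W \<cdot> (A \<cdot> B)"
    by (simp_all only: compose_assoc[symmetric])
  moreover have "Z \<cdot> A = A \<cdot> Z" "Z \<cdot> B = B \<cdot> Z" using Z A B by (simp_all add: center_iff)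
  ultimately show "commutator (W \<cdot> A + Z) B = W \<cdot> commutator A B"
    "commutator A (W \<cdot> B + Z) = W \<cdot> commutator A B"
    by (simp_all add: commutator_def compose_bilinear compose_assoc)
qed

text \<open>The central summand \<open>Z\<close> drops out of the first bracket and \<open>W\<close>
  comes out of it; \<open>n \<ge> 2\<close> guarantees that there is such a bracket. Both directions
  of the equivalence rest on this.\<close>

lemma pn_central_perturbation:
  assumes W: "W \<in> center U" and n: "n \<ge> 2" and A: "\<And>i. 1 \<le> i \<Longrightarrow> i \<le> n \<Longrightarrow> A i \<in> U"
    and Z: "Z \<in> center U"
  shows "pn n (A(1 := W \<cdot> A 1 + Z)) = W \<cdot> pn n A" "pn n (A(2 := W \<cdot> A 2 + Z)) = W \<cdot> pn n A"
proof -
  obtain k where k: "n = Suc (Suc k)" using n by (metis Suc_diff_Suc diff_Suc_Suc add_2_eq_Suc le_Suc_ex)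
  have 12: "A 1 \<in> U" "A 2 \<in> U" using n by (auto intro: A)
  show "pn n (A(1 := W \<cdot> A 1 + Z)) = W \<cdot> pn n A"
    unfolding k
    by (rule pn_central_multiple[OF W]) (use A k commutator_central_multiple(1)[OF W Z 12] in auto)
  show "pn n (A(2 := W \<cdot> A 2 + Z)) = W \<cdot> pn n A"
    unfolding k
    by (rule pn_central_multiple[OF W]) (use A k commutator_central_multiple(2)[OF W Z 12] in auto)
qed

section \<open>Central projections, central carriers and cores\<close>

lemma cinner_diff_left: "cinner (x - y) z = cinner x z - cinner y z"
  using cinner_add_left[of "x - y" y z] by simp

lemma cinner_diff_right: "cinner z (x - y) = cinner z x - cinner z y"
  by (subst (1 2 3) cinner_commute) (simp add: cinner_diff_left)

lemma projection_complement:
  assumes "projection_op R" shows "projection_op (id_blinfun - R)"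
  using assms
  by (simp add: projection_op_def selfadjoint_op_def is_adjoint_def compose_bilinear
      blinfun.diff_left cinner_diff_left cinner_diff_right)

lemma projection_contraction:
  assumes "projection_op R" shows "norm (R x) \<le> norm x"
proof -
  have "(norm (R x))\<^sup>2 \<le> norm (R x) * norm x"
    using norm_cauchy_schwarz[of "R x" x] by (simp add: projection_op_inner[OF assms])
  then show ?thesis
    by (cases "norm (R x) = 0") (auto simp: power2_eq_square mult_le_cancel_left)
qed

lemma central_projection_complement:
  "central_projection U R \<Longrightarrow> central_projection U (id_blinfun - R)"
  by (auto simp: central_projection_def center_iff compose_bilinear projection_complement)

lemma op_le_projection: "projection_op R \<Longrightarrow> op_le R S \<longleftrightarrow> (\<forall>x. (norm (R x))\<^sup>2 \<le> inner (S x) x)"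
  by (simp add: op_le_def inner_eq_Re_cinner[symmetric] projection_op_inner)

text \<open>If \<open>R\<close> is a central projection with \<open>P R = 0\<close>, then \<open>I - R\<close> dominates the central carrier of \<open>P\<close>.\<close>

lemma central_carrier_orthogonal:
  assumes car: "is_central_carrier U P E" and R: "central_projection U R" "P \<cdot> R = 0" and P: "P \<in> U"
  shows "E \<cdot> R = 0"
proof (rule blinfun_eqI)
  fix x
  have "(id_blinfun - R) \<cdot> P = P"
    using R P by (simp add: central_projection_def center_iff compose_bilinear)
  then have "op_le E (id_blinfun - R)"
    using car central_projection_complement[OF R(1)] by (simp add: is_central_carrier_def)
  moreover have "projection_op E" using car by (simp add: is_central_carrier_def central_projection_def)
  ultimately have "(norm (E (R x)))\<^sup>2 \<le> inner ((id_blinfun - R) (R x)) (R x)"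
    by (simp add: op_le_projection)
  also have "(id_blinfun - R) (R x) = ((id_blinfun - R) \<cdot> R) x" by simp
  also have "(id_blinfun - R) \<cdot> R = 0"
    using R(1) by (simp add: central_projection_def projection_op_def compose_bilinear)
  finally show "(E \<cdot> R) x = blinfun_apply 0 x" by simp
qed

text \<open>The hypothesis gives \<open>R \<le> P\<close>, so \<open>R\<close> is a central minorant
  of \<open>P\<close> and lies below the core 0; a projection below 0 vanishes.\<close>

lemma core_free_orthogonal:
  assumes core: "core_free U P" and P_in: "P \<in> U" and P: "projection_op P" and R: "central_projection U R" "(id_blinfun - P) \<cdot> R = 0"
  shows "R = 0"
proof (rule blinfun_eqI)
  fix x
  have pR: "projection_op R" and RZ: "R \<in> center U" using R by (auto simp: central_projection_def)
  have "op_le R P"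
    unfolding op_le_projection[OF pR]
  proof
    fix x
    have "R \<cdot> P = R"
      using R(2) RZ P_in by (simp add: center_iff compose_bilinear)
    then have "norm (R x) = norm (R (P x))" by (metis blinfun_apply_blinfun_compose)
    also have "\<dots> \<le> norm (P x)" by (rule projection_contraction[OF pR])
    finally show "(norm (R x))\<^sup>2 \<le> inner (P x) x"
      by (simp add: projection_op_inner[OF P] power_mono)
  qed
  then have "R \<in> central_minorants U P"
    using RZ pR by (simp add: central_minorants_def projection_op_def)
  then have "op_le R 0" using core by (simp add: core_free_def is_core_def)
  then show "R x = blinfun_apply 0 x" by (simp add: op_le_projection[OF pR])
qed

end

section \<open>Characterization by a central multiplier and a central-valued map\<close>

lemma nat_ge_2_cases: "2 \<le> n \<Longrightarrow> \<exists>k. n = Suc (Suc k)"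
  by (cases n rule: nat.exhaust; cases "n - 1") auto

theorem theorem2p1:
  fixes n :: nat
    and U :: "'h::complex_hilbert operator set"
    and E1 E2 P :: "'h operator"
    and \<phi> :: "'h operator \<Rightarrow> 'h operator"
  assumes "n \<ge> 2"
    and "von_neumann_algebra U"
    and "central_projection U E1"
    and "central_projection U E2"
    and "E1 o\<^sub>L E2 = 0"
    and "E1 + E2 = id_blinfun"
    and "type_I1 (summand U E1)"
    and "no_type_I1_central_summand (summand U E2)"
    and "P \<in> summand U E2"
    and "projection_op P"
    and "core_free U P"
    and "is_central_carrier U P E2"
    and "\<phi> \<in> U \<rightarrow> U"
    and "additive_on U \<phi>"
  shows "(\<forall>A. (\<forall>i\<in>{1..n}. A i \<in> U) \<and> A 1 o\<^sub>L A 2 = P \<longrightarrow>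
            \<phi> (pn n A) = pn n (A(1 := \<phi> (A 1))) \<and>
            pn n (A(1 := \<phi> (A 1))) = pn n (A(2 := \<phi> (A 2))))
     \<longleftrightarrow>
         (\<exists>W \<xi>. W \<in> center U \<and> \<xi> \<in> U \<rightarrow> center U \<and> additive_on U \<xi> \<and>
            (\<forall>A\<in>U. \<phi> A = (W o\<^sub>L A) + \<xi> A) \<and>
            (\<forall>A. (\<forall>i\<in>{1..n}. A i \<in> U) \<and> A 1 o\<^sub>L A 2 = P \<longrightarrow> \<xi> (pn n A) = 0))"
proof -
  interpret von_neumann U by standard fact
  obtain k where n: "n = Suc (Suc k)" using nat_ge_2_cases[OF \<open>n \<ge> 2\<close>] by blast
  have E: "E1 \<in> U" "E2 \<in> U" "\<And>A. A \<in> U \<Longrightarrow> E1 \<cdot> A = A \<cdot> E1" "\<And>A. A \<in> U \<Longrightarrow> E2 \<cdot> A = A \<cdot> E2"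
    using \<open>central_projection U E1\<close> \<open>central_projection U E2\<close>
    by (simp_all add: central_projection_def center_iff)
  have PU: "P \<in> U" using \<open>P \<in> summand U E2\<close> E by (auto simp: summand_def)
  have cP: "corner U P"
    by unfold_locales (use PU \<open>projection_op P\<close> in auto)
  have cQ: "corner U (id_blinfun - P)"
    by unfold_locales (use PU projection_complement[OF \<open>projection_op P\<close>] in auto)
  \<comment> \<open>The annihilator projection of \<open>P\<close> is orthogonal to
    \<open>E2\<close>, and that of \<open>I - P\<close> is 0; these give the two annihilation
    hypotheses.\<close>
  have peirce: "peirce U P"
  proof unfold_locales
    show "P \<cdot> P = P" using \<open>projection_op P\<close> by (simp add: projection_op_def)
    fix A B assume AB: "A \<in> U" "B \<in> U" and "\<And>C. C \<in> U \<Longrightarrow> P \<cdot> C \<cdot> (A \<cdot> B - B \<cdot> A) = 0"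
    then obtain R where R: "central_projection U R" "P \<cdot> R = 0" "A \<cdot> B - B \<cdot> A = R \<cdot> (A \<cdot> B - B \<cdot> A)"
      using corner.annihilator[OF cP] by (meson compose_in diff_in)
    have "E2 \<cdot> (A \<cdot> B - B \<cdot> A) = E2 \<cdot> R \<cdot> (A \<cdot> B - B \<cdot> A)"
      using R(3) by (simp add: compose_assoc)
    also have "\<dots> = 0"
      using central_carrier_orthogonal[OF \<open>is_central_carrier U P E2\<close> R(1,2) PU] by simp
    finally have 2: "E2 \<cdot> (A \<cdot> B - B \<cdot> A) = 0" .
    have E11: "E1 \<cdot> E1 = E1"
      using \<open>central_projection U E1\<close> by (simp add: central_projection_def projection_op_def)
    \<comment> \<open>Products in the summand \<open>U E1\<close> are \<open>E1\<close> times
      products in \<open>U\<close>, so commutativity of the summand reads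
      \<open>E1 A B = E1 B A\<close>.\<close>
    have move: "F \<cdot> E1 \<cdot> (G \<cdot> E1) = E1 \<cdot> (F \<cdot> G)" if "F \<in> U" "G \<in> U" for F G
    proof -
      have "F \<cdot> E1 \<cdot> (G \<cdot> E1) = E1 \<cdot> F \<cdot> (E1 \<cdot> G)" by (simp only: E(3)[OF that(1)] E(3)[OF that(2)])
      also have "\<dots> = E1 \<cdot> (F \<cdot> E1) \<cdot> G" by (simp only: compose_assoc)
      also have "\<dots> = E1 \<cdot> E1 \<cdot> F \<cdot> G" by (simp only: compose_assoc E(3)[OF that(1), symmetric])
      finally show ?thesis by (simp only: E11 compose_assoc)
    qed
    have "E1 \<cdot> (A \<cdot> B) = E1 \<cdot> (B \<cdot> A)"
      using \<open>type_I1 (summand U E1)\<close> AB unfolding type_I1_def summand_def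
      by (simp add: move)
    then have "(E1 + E2) \<cdot> (A \<cdot> B - B \<cdot> A) = 0"
      using 2 by (simp add: compose_bilinear)
    then show "A \<cdot> B = B \<cdot> A" by (simp add: \<open>E1 + E2 = id_blinfun\<close>)
  next
    fix D assume D: "D \<in> U" "\<And>C. C \<in> U \<Longrightarrow> D \<cdot> C \<cdot> (id_blinfun - P) = 0"
    obtain R where R: "central_projection U R" "(id_blinfun - P) \<cdot> R = 0" "D = D \<cdot> R"
      using corner.annihilator[OF cQ] D by meson
    have "R = 0"
      by (rule core_free_orthogonal[OF \<open>core_free U P\<close> PU \<open>projection_op P\<close> R(1,2)])
    then show "D = 0" using R(3) by simp
  qed (rule PU)
  then interpret peirce U P .
  show ?thesis
  proof (rule iffI, goal_cases)
    case 1
    have triple: "\<phi> (((\<lambda>X. commutator X P) ^^ k) (commutator A B)) = ((\<lambda>X. commutator X P) ^^ k) (commutator (\<phi> A) B) \<and>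
      ((\<lambda>X. commutator X P) ^^ k) (commutator (\<phi> A) B) = ((\<lambda>X. commutator X P) ^^ k) (commutator A (\<phi> B))"
      if "A \<in> U" "B \<in> U" "A \<cdot> B = P" for A B
    proof -
      \<comment> \<open>All arguments from the third on are \<open>P\<close>; index 0 receives
        \<open>P\<close> as well, but \<open>pn n\<close> reads only the indices 1 to
        \<open>n\<close>.\<close>
      let ?A = "\<lambda>i::nat. if i = 1 then A else if i = 2 then B else P"
      have "pn n ?A = ((\<lambda>X. commutator X P) ^^ k) (commutator A B)"
        "pn n (?A(1 := \<phi> (?A 1))) = ((\<lambda>X. commutator X P) ^^ k) (commutator (\<phi> A) B)"
        "pn n (?A(2 := \<phi> (?A 2))) = ((\<lambda>X. commutator X P) ^^ k) (commutator A (\<phi> B))"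
        unfolding n by (subst pn_tail_const[where P = P]; simp)+
      moreover have "(\<forall>i\<in>{1..n}. ?A i \<in> U) \<and> ?A 1 \<cdot> ?A 2 = P" using that PU by simp
      from 1[rule_format, OF this] have "\<phi> (pn n ?A) = pn n (?A(1 := \<phi> (?A 1))) \<and> pn n (?A(1 := \<phi> (?A 1))) = pn n (?A(2 := \<phi> (?A 2)))"
        .
      ultimately show ?thesis by simp
    qed
    interpret local_lie_centralizer U P \<phi> k
      by unfold_locales (use triple \<open>\<phi> \<in> U \<rightarrow> U\<close> \<open>additive_on U \<phi>\<close> in \<open>auto simp: additive_on_def\<close>)
    obtain W where W: "W \<in> center U" and xi: "\<And>A. A \<in> U \<Longrightarrow> \<phi> A - W \<cdot> A \<in> center U"
      using central_decomposition[OF corner.central_extension[OF cP] corner.central_extension[OF cQ, folded Q_def]]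
      by blast
    let ?xi = "\<lambda>A. \<phi> A - W \<cdot> A"
    have "?xi (pn n A) = 0" if A: "\<forall>i\<in>{1..n}. A i \<in> U" "A 1 \<cdot> A 2 = P" for A
    proof -
      \<comment> \<open>Writing \<open>\<phi> (A 1)\<close> as a central perturbation of
        \<open>W \<cdot> A 1\<close> shows that \<open>\<phi>\<close> multiplies
        \<open>pn n A\<close> by \<open>W\<close>.\<close>
      have "\<phi> (pn n A) = pn n (A(1 := W \<cdot> A 1 + ?xi (A 1)))" using 1 A by simp
      also have "\<dots> = W \<cdot> pn n A"
        using A n by (intro pn_central_perturbation W xi \<open>n \<ge> 2\<close>) auto
      finally show ?thesis by simp
    qed
    moreover have "additive_on U ?xi"
      by (simp add: additive_on_def phi_add compose_bilinear)
    ultimately show ?case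
      using W xi by (intro exI[of _ W] exI[of _ ?xi]) auto
  next
    case 2
    then obtain W \<xi> where W: "W \<in> center U" "\<xi> \<in> U \<rightarrow> center U"
      "\<And>A. A \<in> U \<Longrightarrow> \<phi> A = W \<cdot> A + \<xi> A"
      "\<And>A. (\<forall>i\<in>{1..n}. A i \<in> U) \<and> A 1 \<cdot> A 2 = P \<Longrightarrow> \<xi> (pn n A) = 0"
      by blast
    show ?case
    proof (intro allI impI)
      fix A assume A: "(\<forall>i\<in>{1..n}. A i \<in> U) \<and> A 1 \<cdot> A 2 = P"
      then have Ai: "\<And>i. 1 \<le> i \<Longrightarrow> i \<le> n \<Longrightarrow> A i \<in> U" by simp
      have 12: "A 1 \<in> U" "A 2 \<in> U" using Ai \<open>n \<ge> 2\<close> by auto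
      \<comment> \<open>All three expressions equal \<open>W \<cdot> pn n A\<close>: here because
        \<open>\<xi>\<close> vanishes on \<open>pn n A\<close>, below because the central values of
        \<open>\<xi>\<close> drop out of the first bracket.\<close>
      have "\<phi> (pn n A) = W \<cdot> pn n A" using W(3)[OF pn_in[OF Ai]] W(4)[OF A] by simp
      moreover have "pn n (A(1 := \<phi> (A 1))) = W \<cdot> pn n A"
        unfolding W(3)[OF 12(1)] using W(2) 12
        by (intro pn_central_perturbation(1) W(1) \<open>n \<ge> 2\<close> Ai) auto
      moreover have "pn n (A(2 := \<phi> (A 2))) = W \<cdot> pn n A"
        unfolding W(3)[OF 12(2)] using W(2) 12
        by (intro pn_central_perturbation(2) W(1) \<open>n \<ge> 2\<close> Ai) auto
      ultimately show "\<phi> (pn n A) = pn n (A(1 := \<phi> (A 1))) \<and>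
          pn n (A(1 := \<phi> (A 1))) = pn n (A(2 := \<phi> (A 2)))" by simp
    qed
  qed
qed

end
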